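(* Isomorphism of profinite groups is classifiable by countable structures. That is, let $\cong$ be the equivalence relation on $\mathcal N(\widehat F_\omega)$ under which $R,S\in\mathcal N(\widehat F_\omega)$ are equivalent iff the profinite groups $\widehat F_\omega/R$ and $\widehat F_\omega/S$ are isomorphic as topological groups. Then there are a countable signature $\mathcal L$ and a Borel function $g:\mathcal N(\widehat F_\omega)\to \mathrm{Mod}(\mathcal L)$ such that for all $R,S\in\mathcal N(\widehat F_\omega)$, $\widehat F_\omega/R\cong\widehat F_\omega/S$ if and only if $g(R)$ and $g(S)$ are isomorphic $\mathcal L$-structures.
   Context: A profinite group is a compact, totally disconnected topological group; all profinite groups here are countably based. $\widehat F_\omega$ denotes the free profinite group on a sequence of generators $x_0,x_1,x_2,\ldots$ converging to $1$: it is the completion (inverse limit of the quotients $F_\omega/U$) of the free group $F_\omega$ on $x_0,x_1,\ldots$ with respect to the system of all normal subgroups $U$ of finite index in $F_\omega$ that contain $x_i$ for almost every $i$. Every countably based profinite group is isomorphic to $\widehat F_\omega/R$ for some closed normal subgroup $R$ of $\widehat F_\omega$. $\mathcal N(\widehat F_\omega)$ is the set of closed normal subgroups of $\widehat F_\omega$. Fixing a bi-invariant metric $\delta$ on $\widehat F_\omega$ compatible with its topology, $\mathcal N(\widehat F_\omega)$ is equipped with the Hausdorff metric $\delta_H(A,B)=\max(\sup_{x\in A}\inf_{y\in B}\delta(x,y),\ \sup_{y\in B}\inf_{x\in A}\delta(x,y))$, which makes it a compact Polish space. For a countable signature $\mathcal L$, $\mathrm{Mod}(\mathcal L)$ denotes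 the Polish space of $\mathcal L$-structures with domain $\omega$. *)

theory Defs
  imports "HOL-Analysis.Analysis" "HOL-Algebra.Coset"
begin

section \<open>The free group\<close>

text \<open>A letter \<open>(x, True)\<close> stands for the generator \<open>x\<close>, and \<open>(x, False)\<close> for its inverse.\<close>

inductive word_equiv :: "('x \<times> bool) list \<Rightarrow> ('x \<times> bool) list \<Rightarrow> bool" where
  word_refl: "word_equiv u u"
| word_sym: "word_equiv u v \<Longrightarrow> word_equiv v u"
| word_trans: "word_equiv u v \<Longrightarrow> word_equiv v w \<Longrightarrow> word_equiv u w"
| word_cancel: "word_equiv (u @ [(x, b), (x, \<not> b)] @ v) (u @ v)"

definition word_class :: "('x \<times> bool) list \<Rightarrow> ('x \<times> bool) list set" where
  "word_class u = {v. word_equiv u v}"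

definition free_group :: "('x \<times> bool) list set monoid" where
  "free_group =
     \<lparr>carrier = range word_class,
      monoid.mult = (\<lambda>A B. {w. \<exists>a\<in>A. \<exists>b\<in>B. word_equiv (a @ b) w}),
      one = word_class []\<rparr>"

definition generator :: "'x \<Rightarrow> ('x \<times> bool) list set" where
  "generator x = word_class [(x, True)]"

lemma word_equiv_append:
  assumes "word_equiv a a'" "word_equiv b b'"
  shows "word_equiv (a @ b) (a' @ b')"
proof -
  have 1: "word_equiv (a @ b) (a' @ b)" for b
    using assms(1)
  proof (induction rule: word_equiv.induct)
    case (word_cancel u x c v)
    show ?case using word_equiv.word_cancel[of u x c "v @ b"] by simp
  qed (blast intro: word_equiv.intros)+
  have 2: "word_equiv (a' @ b) (a' @ b')"
    using assms(2)
  proof (induction rule: word_equiv.induct)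
    case (word_cancel u x c v)
    show ?case using word_equiv.word_cancel[of "a' @ u" x c v] by simp
  qed (blast intro: word_equiv.intros)+
  show ?thesis using 1 2 by (blast intro: word_trans)
qed

lemma free_group_mult:
  "word_class a \<otimes>\<^bsub>free_group\<^esub> word_class b = word_class (a @ b)"
proof -
  have "(\<exists>a'\<in>word_class a. \<exists>b'\<in>word_class b. word_equiv (a' @ b') w) \<longleftrightarrow> word_equiv (a @ b) w" for w
  proof
    assume "\<exists>a'\<in>word_class a. \<exists>b'\<in>word_class b. word_equiv (a' @ b') w"
    then obtain a' b' where "word_equiv a a'" "word_equiv b b'" "word_equiv (a' @ b') w"
      by (auto simp: word_class_def)
    then show "word_equiv (a @ b) w"
      using word_trans word_equiv_append by metis
  next
    assume "word_equiv (a @ b) w"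
    moreover have "a \<in> word_class a" "b \<in> word_class b"
      by (simp_all add: word_class_def word_refl)
    ultimately show "\<exists>a'\<in>word_class a. \<exists>b'\<in>word_class b. word_equiv (a' @ b') w"
      by blast
  qed
  then show ?thesis
    by (simp add: free_group_def word_class_def[of "a @ b"])
qed

lemma word_equiv_inverse:
  "word_equiv (rev (map (\<lambda>(x, b). (x, \<not> b)) a) @ a) []"
proof (induction a)
  case Nil
  then show ?case by (simp add: word_refl)
next
  case (Cons p a)
  obtain x b where p: "p = (x, b)" by force
  let ?i = "\<lambda>a. rev (map (\<lambda>(x, b). (x, \<not> b)) a)"
  have "word_equiv (?i a @ [(x, \<not> b), (x, \<not> \<not> b)] @ a) (?i a @ a)"
    by (rule word_cancel)
  then have "word_equiv (?i a @ [(x, \<not> b), (x, b)] @ a) []"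
    using Cons by (simp add: word_trans[OF _ Cons])
  then show ?case by (simp add: p)
qed

lemma group_free_group: "group (free_group :: ('x \<times> bool) list set monoid)"
proof (rule groupI)
  fix x y z :: "('x \<times> bool) list set"
  assume "x \<in> carrier free_group" "y \<in> carrier free_group" "z \<in> carrier free_group"
  then obtain a b c where "x = word_class a" "y = word_class b" "z = word_class c"
    by (auto simp: free_group_def)
  then show "x \<otimes>\<^bsub>free_group\<^esub> y \<otimes>\<^bsub>free_group\<^esub> z = x \<otimes>\<^bsub>free_group\<^esub> (y \<otimes>\<^bsub>free_group\<^esub> z)"
    by (simp add: free_group_mult)
next
  fix x y :: "('x \<times> bool) list set"
  assume "x \<in> carrier free_group" "y \<in> carrier free_group"
  then obtain a b where "x = word_class a" "y = word_class b"
    by (auto simp: free_group_def)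
  then have "x \<otimes>\<^bsub>free_group\<^esub> y = word_class (a @ b)"
    by (simp add: free_group_mult)
  then show "x \<otimes>\<^bsub>free_group\<^esub> y \<in> carrier free_group"
    by (simp add: free_group_def)
next
  fix x :: "('x \<times> bool) list set"
  assume "x \<in> carrier free_group"
  then obtain a where a: "x = word_class a"
    by (auto simp: free_group_def)
  have one: "\<one>\<^bsub>free_group\<^esub> = word_class []" by (simp add: free_group_def)
  show "\<one>\<^bsub>free_group\<^esub> \<otimes>\<^bsub>free_group\<^esub> x = x"
    by (simp add: one a free_group_mult)
  have "word_class (rev (map (\<lambda>(x, b). (x, \<not> b)) a) @ a) = word_class []"
    unfolding word_class_def
    using word_equiv_inverse[of a] by (blast intro: word_sym word_trans)
  then show "\<exists>y\<in>carrier free_group. y \<otimes>\<^bsub>free_group\<^esub> x = \<one>\<^bsub>free_group\<^esub>"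
    by (intro bexI[of _ "word_class (rev (map (\<lambda>(x, b). (x, \<not> b)) a))"])
       (auto simp: one a free_group_mult, simp add: free_group_def)
qed (simp add: free_group_def)


section \<open>The free profinite group on a sequence of generators converging to 1\<close>

type_synonym free_elem = "(nat \<times> bool) list set"

abbreviation F_omega :: "free_elem monoid" where
  "F_omega \<equiv> free_group"

definition admissible :: "free_elem set set" where
  "admissible = {U. U \<lhd> F_omega \<and> finite (rcosets\<^bsub>F_omega\<^esub> U) \<and> finite {i. generator i \<notin> U}}"

text \<open>
  For \<open>U \<subseteq> V\<close>, the canonical projection from \<open>F_omega Mod U\<close> to \<open>F_omega Mod V\<close> sends
  a coset of \<open>U\<close> to the unique coset of \<open>V\<close> that contains it, so an element of the inverse
  limit is a family \<open>a\<close> of cosets with \<open>a U \<subseteq> a V\<close> whenever \<open>U \<subseteq> V\<close>.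
\<close>

type_synonym profinite_elem = "free_elem set \<Rightarrow> free_elem set"

definition Fhat_carrier :: "profinite_elem set" where
  "Fhat_carrier = {a \<in> (\<Pi>\<^sub>E U\<in>admissible. carrier (F_omega Mod U)).
     \<forall>U\<in>admissible. \<forall>V\<in>admissible. U \<subseteq> V \<longrightarrow> a U \<subseteq> a V}"

definition Fhat :: "profinite_elem monoid" where
  "Fhat =
     \<lparr>carrier = Fhat_carrier,
      monoid.mult = (\<lambda>a b. \<lambda>U\<in>admissible. a U \<otimes>\<^bsub>F_omega Mod U\<^esub> b U),
      one = (\<lambda>U\<in>admissible. \<one>\<^bsub>F_omega Mod U\<^esub>)\<rparr>"

definition Fhat_topology :: "profinite_elem topology" where
  "Fhat_topology = subtopology
     (product_topology (\<lambda>U. discrete_topology (carrier (F_omega Mod U))) admissible)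
     Fhat_carrier"

lemma topspace_Fhat_topology: "topspace Fhat_topology = carrier Fhat"
  by (auto simp: Fhat_topology_def Fhat_def Fhat_carrier_def)

lemma group_Fhat: "group Fhat"
proof -
  have nrm: "U \<lhd> F_omega" if "U \<in> admissible" for U
    using that by (simp add: admissible_def)
  have grp: "group (F_omega Mod U)" if "U \<in> admissible" for U
    using nrm[OF that] by (rule normal.factorgroup_is_group)
  have inv_coset: "set_inv\<^bsub>F_omega\<^esub> X = inv\<^bsub>F_omega Mod U\<^esub> X"
    if "U \<in> admissible" "X \<in> carrier (F_omega Mod U)" for U X
    using normal.inv_FactGroup[OF nrm[OF that(1)] that(2)] by simp
  show ?thesis
  proof (rule groupI)
    fix x y assume "x \<in> carrier Fhat" "y \<in> carrier Fhat"
    then have xy: "x \<in> Fhat_carrier" "y \<in> Fhat_carrier" by (simp_all add: Fhat_def)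
    have "x U \<otimes>\<^bsub>F_omega Mod U\<^esub> y U \<in> carrier (F_omega Mod U)" if "U \<in> admissible" for U
      using xy that grp[OF that]
      by (intro monoid.m_closed) (auto simp: Fhat_carrier_def group.is_monoid)
    moreover have "x U \<otimes>\<^bsub>F_omega Mod U\<^esub> y U \<subseteq> x V \<otimes>\<^bsub>F_omega Mod V\<^esub> y V"
      if "U \<in> admissible" "V \<in> admissible" "U \<subseteq> V" for U V
      using xy that by (auto simp: Fhat_carrier_def FactGroup_def intro!: mono_set_mult del: subsetI)
    ultimately show "x \<otimes>\<^bsub>Fhat\<^esub> y \<in> carrier Fhat"
      by (auto simp: Fhat_def Fhat_carrier_def)
  next
    have "\<one>\<^bsub>F_omega Mod U\<^esub> \<in> carrier (F_omega Mod U)" if "U \<in> admissible" for U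
      using grp[OF that] by (intro monoid.one_closed group.is_monoid)
    then show "\<one>\<^bsub>Fhat\<^esub> \<in> carrier Fhat"
      by (auto simp: Fhat_def Fhat_carrier_def)
  next
    fix x y z assume "x \<in> carrier Fhat" "y \<in> carrier Fhat" "z \<in> carrier Fhat"
    then have xyz: "x U \<in> carrier (F_omega Mod U)" "y U \<in> carrier (F_omega Mod U)"
      "z U \<in> carrier (F_omega Mod U)" if "U \<in> admissible" for U
      using that by (auto simp: Fhat_def Fhat_carrier_def)
    have "x U \<otimes>\<^bsub>F_omega Mod U\<^esub> y U \<otimes>\<^bsub>F_omega Mod U\<^esub> z U =
        x U \<otimes>\<^bsub>F_omega Mod U\<^esub> (y U \<otimes>\<^bsub>F_omega Mod U\<^esub> z U)" if "U \<in> admissible" for U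
      using xyz[OF that] grp[OF that] by (intro monoid.m_assoc group.is_monoid)
    then show "x \<otimes>\<^bsub>Fhat\<^esub> y \<otimes>\<^bsub>Fhat\<^esub> z = x \<otimes>\<^bsub>Fhat\<^esub> (y \<otimes>\<^bsub>Fhat\<^esub> z)"
      by (simp add: Fhat_def fun_eq_iff restrict_def del: mult_FactGroup)
  next
    fix x assume "x \<in> carrier Fhat"
    then have x: "x \<in> Fhat_carrier" by (simp add: Fhat_def)
    then have x': "x U \<in> carrier (F_omega Mod U)" if "U \<in> admissible" for U
      using that by (auto simp: Fhat_carrier_def)
    have ext: "x U = undefined" if "U \<notin> admissible" for U
      using x that by (auto simp: Fhat_carrier_def)
    have "\<one>\<^bsub>F_omega Mod U\<^esub> \<otimes>\<^bsub>F_omega Mod U\<^esub> x U = x U" if "U \<in> admissible" for U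
      using x'[OF that] grp[OF that] by (intro monoid.l_one group.is_monoid)
    then show "\<one>\<^bsub>Fhat\<^esub> \<otimes>\<^bsub>Fhat\<^esub> x = x"
      using ext by (simp add: Fhat_def fun_eq_iff restrict_def del: mult_FactGroup one_FactGroup)
    let ?y = "\<lambda>U\<in>admissible. inv\<^bsub>F_omega Mod U\<^esub> (x U)"
    have "inv\<^bsub>F_omega Mod U\<^esub> (x U) \<in> carrier (F_omega Mod U)" if "U \<in> admissible" for U
      using grp[OF that] x'[OF that] by (rule group.inv_closed)
    moreover have "inv\<^bsub>F_omega Mod U\<^esub> (x U) \<subseteq> inv\<^bsub>F_omega Mod V\<^esub> (x V)"
      if "U \<in> admissible" "V \<in> admissible" "U \<subseteq> V" for U V
    proof -
      have "x U \<subseteq> x V" using x that by (auto simp: Fhat_carrier_def)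
      then have "set_inv\<^bsub>F_omega\<^esub> (x U) \<subseteq> set_inv\<^bsub>F_omega\<^esub> (x V)"
        by (auto simp: SET_INV_def)
      then show ?thesis
        using inv_coset[OF that(1) x'[OF that(1)]] inv_coset[OF that(2) x'[OF that(2)]] by simp
    qed
    ultimately have "?y \<in> carrier Fhat" by (auto simp: Fhat_def Fhat_carrier_def)
    moreover have "inv\<^bsub>F_omega Mod U\<^esub> (x U) \<otimes>\<^bsub>F_omega Mod U\<^esub> x U = \<one>\<^bsub>F_omega Mod U\<^esub>"
      if "U \<in> admissible" for U
      using grp[OF that] x'[OF that] by (rule group.l_inv)
    then have "?y \<otimes>\<^bsub>Fhat\<^esub> x = \<one>\<^bsub>Fhat\<^esub>"
      by (simp add: Fhat_def fun_eq_iff restrict_def del: mult_FactGroup one_FactGroup)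
    ultimately show "\<exists>y\<in>carrier Fhat. y \<otimes>\<^bsub>Fhat\<^esub> x = \<one>\<^bsub>Fhat\<^esub>" by blast
  qed
qed


section \<open>Closed normal subgroups and quotients of topological groups\<close>

definition closed_normal_subgroups :: "('a, 'b) monoid_scheme \<Rightarrow> 'a topology \<Rightarrow> 'a set set" where
  "closed_normal_subgroups G T = {R. R \<lhd> G \<and> closedin T R}"

definition quotient_group_topology ::
    "('a, 'b) monoid_scheme \<Rightarrow> 'a topology \<Rightarrow> 'a set \<Rightarrow> 'a set topology" where
  "quotient_group_topology G T R = topology (\<lambda>W. W \<subseteq> carrier (G Mod R) \<and>
     openin T {x \<in> topspace T. R #>\<^bsub>G\<^esub> x \<in> W})"

lemma openin_quotient_group_topology:
  "openin (quotient_group_topology G T R) W \<longleftrightarrow>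
     W \<subseteq> carrier (G Mod R) \<and> openin T {x \<in> topspace T. R #>\<^bsub>G\<^esub> x \<in> W}"
proof -
  have "openin T {x \<in> topspace T. R #>\<^bsub>G\<^esub> x \<in> A \<inter> B}"
    if "openin T {x \<in> topspace T. R #>\<^bsub>G\<^esub> x \<in> A}" "openin T {x \<in> topspace T. R #>\<^bsub>G\<^esub> x \<in> B}"
    for A B
    using openin_Int[OF that] by (rule back_subst[where P = "openin T"]) auto
  moreover have "openin T {x \<in> topspace T. R #>\<^bsub>G\<^esub> x \<in> \<Union>K}"
    if "\<And>A. A \<in> K \<Longrightarrow> openin T {x \<in> topspace T. R #>\<^bsub>G\<^esub> x \<in> A}" for K
  proof -
    have "openin T (\<Union>A\<in>K. {x \<in> topspace T. R #>\<^bsub>G\<^esub> x \<in> A})"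
      using that by blast
    then show ?thesis by (rule back_subst[where P = "openin T"]) auto
  qed
  ultimately have "istopology (\<lambda>W. W \<subseteq> carrier (G Mod R) \<and>
     openin T {x \<in> topspace T. R #>\<^bsub>G\<^esub> x \<in> W})"
    unfolding istopology_def by (intro conjI allI impI; simp add: le_infI1 Sup_least)
  then show ?thesis
    by (simp add: quotient_group_topology_def)
qed

definition topological_group_isomorphic ::
    "('a, 'b) monoid_scheme \<Rightarrow> 'a topology \<Rightarrow> ('c, 'd) monoid_scheme \<Rightarrow> 'c topology \<Rightarrow> bool" where
  "topological_group_isomorphic G TG H TH \<longleftrightarrow> (\<exists>f. f \<in> iso G H \<and> homeomorphic_map TG TH f)"


section \<open>Metrics\<close>

definition compatible_metric :: "'a topology \<Rightarrow> ('a \<Rightarrow> 'a \<Rightarrow> real) \<Rightarrow> bool" where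
  "compatible_metric T d \<longleftrightarrow>
     Metric_space (topspace T) d \<and> Metric_space.mtopology (topspace T) d = T"

definition bi_invariant :: "('a, 'b) monoid_scheme \<Rightarrow> ('a \<Rightarrow> 'a \<Rightarrow> real) \<Rightarrow> bool" where
  "bi_invariant G d \<longleftrightarrow> (\<forall>x\<in>carrier G. \<forall>y\<in>carrier G. \<forall>z\<in>carrier G.
     d (z \<otimes>\<^bsub>G\<^esub> x) (z \<otimes>\<^bsub>G\<^esub> y) = d x y \<and> d (x \<otimes>\<^bsub>G\<^esub> z) (y \<otimes>\<^bsub>G\<^esub> z) = d x y)"

text \<open>
  The Hausdorff metric on a family \<open>C\<close> of sets. The value \<open>0\<close> off \<open>C\<close> is only a convention:
  the locale \<open>Metric_space\<close> asks for nonnegativity at all arguments, whereas suprema and infima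
  of empty or unbounded sets of reals are unspecified.
\<close>

definition hausdorff_metric ::
    "'a set set \<Rightarrow> ('a \<Rightarrow> 'a \<Rightarrow> real) \<Rightarrow> 'a set \<Rightarrow> 'a set \<Rightarrow> real" where
  "hausdorff_metric C d A B =
     (if A \<in> C \<and> B \<in> C
      then max (SUP x\<in>A. INF y\<in>B. d x y) (SUP y\<in>B. INF x\<in>A. d x y)
      else 0)"

definition borel_of :: "'a topology \<Rightarrow> 'a measure" where
  "borel_of X = sigma (topspace X) {U. openin X U}"


section \<open>Countable structures\<close>

text \<open>Constant symbols are function symbols of arity 0.\<close>

record 's signature =
  rel_syms :: "'s set"
  fun_syms :: "'s set"
  rel_arity :: "'s \<Rightarrow> nat"
  fun_arity :: "'s \<Rightarrow> nat"

definition countable_signature :: "'s signature \<Rightarrow> bool" where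
  "countable_signature L \<longleftrightarrow> countable (rel_syms L) \<and> countable (fun_syms L)"

text \<open>
  A structure with domain \<open>\<omega>\<close> is the pair of the interpretations of the relation symbols and of
  the function symbols; a tuple in \<open>\<omega>\<^sup>n\<close> is a list of length \<open>n\<close>.
\<close>

type_synonym 's nat_structure = "('s \<Rightarrow> nat list \<Rightarrow> bool) \<times> ('s \<Rightarrow> nat list \<Rightarrow> nat)"

definition Mod_topology :: "'s signature \<Rightarrow> 's nat_structure topology" where
  "Mod_topology L = prod_topology
     (product_topology (\<lambda>r. product_topology (\<lambda>_. discrete_topology UNIV)
        {xs. length xs = rel_arity L r}) (rel_syms L))
     (product_topology (\<lambda>f. product_topology (\<lambda>_. discrete_topology UNIV)
        {xs. length xs = fun_arity L f}) (fun_syms L))"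

definition structure_isomorphic :: "'s signature \<Rightarrow> 's nat_structure \<Rightarrow> 's nat_structure \<Rightarrow> bool" where
  "structure_isomorphic L A B \<longleftrightarrow> (\<exists>p :: nat \<Rightarrow> nat. bij p \<and>
     (\<forall>r\<in>rel_syms L. \<forall>xs. length xs = rel_arity L r \<longrightarrow> fst A r xs = fst B r (map p xs)) \<and>
     (\<forall>f\<in>fun_syms L. \<forall>xs. length xs = fun_arity L f \<longrightarrow> p (snd A f xs) = snd B f (map p xs)))"


section \<open>The space of closed normal subgroups\<close>

abbreviation N_Fhat :: "profinite_elem set set" where
  "N_Fhat \<equiv> closed_normal_subgroups Fhat Fhat_topology"

definition N_Fhat_topology ::
    "(profinite_elem \<Rightarrow> profinite_elem \<Rightarrow> real) \<Rightarrow> profinite_elem set topology" where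
  "N_Fhat_topology \<delta> = Metric_space.mtopology N_Fhat (hausdorff_metric N_Fhat \<delta>)"

definition quotients_isomorphic :: "profinite_elem set \<Rightarrow> profinite_elem set \<Rightarrow> bool" where
  "quotients_isomorphic R S \<longleftrightarrow> topological_group_isomorphic
     (Fhat Mod R) (quotient_group_topology Fhat Fhat_topology R)
     (Fhat Mod S) (quotient_group_topology Fhat Fhat_topology S)"

end

theory Submission
  imports Defs
begin

text \<open>
  A profinite group can be recovered from the set of its nonempty clopen subsets, equipped with
  the relations \<open>A \<subseteq> B\<close> and \<open>A B \<subseteq> C\<close>: this is Stone duality, and since products of points are
  determined by continuity, the second relation makes the induced homeomorphism a homomorphism.
  The nonempty clopen subsets of the free profinite group form a countable set, and those of its
  quotient by \<open>R\<close> are exactly their images. Fix an enumeration \<open>e\<close> of this countable set in which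
  each clopen set occurs infinitely often, and let \<open>g R\<close> have the relations
  \<open>R e\<^sub>i \<subseteq> R e\<^sub>j\<close> and \<open>R e\<^sub>i e\<^sub>j \<subseteq> R e\<^sub>k\<close>. Different indices may name the same clopen subset of the
  quotient, but each name class is countably infinite, so an isomorphism of quotients lifts to a
  permutation of \<open>\<omega>\<close>. If \<open>A\<close> is a union of \<open>\<epsilon>\<close>-balls, then bi-invariance of the metric gives
  \<open>R A = S A\<close> for all \<open>R, S\<close> at Hausdorff distance less than \<open>\<epsilon>\<close>. Hence each coordinate of \<open>g\<close> is
  locally constant, and \<open>g\<close> is even continuous.
\<close>


section \<open>Stone spaces\<close>

text \<open>Leaving out the empty set makes disjointness visible in the order: two clopen sets are
  disjoint iff no member lies below both.\<close>

definition nonempty_clopens :: "'a topology \<Rightarrow> 'a set set" where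
  "nonempty_clopens X = {A. openin X A \<and> closedin X A \<and> A \<noteq> {}}"

text \<open>With a clopen base, T0 already gives the Hausdorff property, so these are the usual
  Stone spaces; T0 is the form that is checked directly for quotients.\<close>

definition stone_space :: "'a topology \<Rightarrow> bool" where
  "stone_space X \<longleftrightarrow> compact_space X \<and> t0_space X \<and>
     (\<forall>W x. openin X W \<and> x \<in> W \<longrightarrow> (\<exists>A\<in>nonempty_clopens X. x \<in> A \<and> A \<subseteq> W))"

lemma stone_space_base:
  assumes "stone_space X" "openin X W" "x \<in> W"
  obtains A where "A \<in> nonempty_clopens X" "x \<in> A" "A \<subseteq> W"
  using assms unfolding stone_space_def by blast

text \<open>One implication suffices because complements of clopen sets are clopen: a clopen set
  around \<open>y\<close> that misses \<open>x\<close> would have a complement that contains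
  \<open>x\<close> but not \<open>y\<close>.\<close>

lemma stone_space_eqI:
  assumes X: "stone_space X" and xy: "x \<in> topspace X" "y \<in> topspace X"
    and imp: "\<And>A. A \<in> nonempty_clopens X \<Longrightarrow> x \<in> A \<Longrightarrow> y \<in> A"
  shows "x = y"
proof (rule ccontr)
  assume "x \<noteq> y"
  then obtain U where U: "openin X U" "x \<notin> U \<longleftrightarrow> y \<in> U"
    using X xy unfolding stone_space_def t0_space_def by metis
  show False
  proof (cases "x \<in> U")
    case True
    then show False
      using U imp stone_space_base[OF X U(1) True] by blast
  next
    case False
    then obtain A where A: "A \<in> nonempty_clopens X" "y \<in> A" "A \<subseteq> U"
      using U stone_space_base[OF X U(1)] by blast
    have "topspace X - A \<in> nonempty_clopens X"
      using A xy False by (auto simp: nonempty_clopens_def)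
    then show False
      using imp A False xy by blast
  qed
qed

text \<open>The clopen neighbourhoods of \<open>x\<close> form an ultrafilter. Below finitely many
  of them lies another one, \<open>B k\<close>, so the corresponding sets in \<open>Y\<close> all
  contain the nonempty \<open>C k\<close>; compactness of \<open>Y\<close> then gives a common
  point.\<close>

lemma stone_space_point_transfer:
  fixes B :: "'i \<Rightarrow> 'a set" and C :: "'i \<Rightarrow> 'b set"
  assumes X: "stone_space X" and Y: "stone_space Y"
    and B: "range B = nonempty_clopens X" and C: "range C = nonempty_clopens Y"
    and le: "\<And>i j. B i \<subseteq> B j \<longleftrightarrow> C i \<subseteq> C j"
    and x: "x \<in> topspace X"
  shows "\<exists>y\<in>topspace Y. \<forall>i. y \<in> C i \<longleftrightarrow> x \<in> B i"
proof -
  have Bi: "openin X (B i)" "closedin X (B i)" "B i \<noteq> {}" for i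
    using B by (auto simp: nonempty_clopens_def)
  have Ci: "openin Y (C i)" "closedin Y (C i)" "C i \<noteq> {}" for i
    using C by (auto simp: nonempty_clopens_def)
  have baseB: "\<exists>i. x \<in> B i \<and> B i \<subseteq> W" if "openin X W" "x \<in> W" for W
    using stone_space_base[OF X that] B by (metis rangeE)
  have "\<Inter>\<F> \<noteq> {}" if F: "finite \<F>" "\<F> \<subseteq> C ` {i. x \<in> B i}" for \<F>
  proof -
    obtain J where J: "finite J" "J \<subseteq> {i. x \<in> B i}" "\<F> = C ` J"
      using finite_subset_image[OF F] by metis
    \<comment> \<open>The factor \<open>topspace X\<close> covers the case \<open>J = {}\<close>,
      where the intersection of the family is \<open>UNIV\<close>.\<close>
    have "openin X (topspace X \<inter> \<Inter>(B ` J))"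
      using J Bi by (cases "J = {}") (auto intro!: openin_Int openin_Inter)
    then obtain k where "x \<in> B k" "B k \<subseteq> topspace X \<inter> \<Inter>(B ` J)"
      using baseB[of "topspace X \<inter> \<Inter>(B ` J)"] J x by blast
    then have "C k \<subseteq> \<Inter>(C ` J)"
      using le by blast
    then show ?thesis
      using Ci(3)[of k] J by blast
  qed
  then have "\<Inter>(C ` {i. x \<in> B i}) \<noteq> {}"
    using Y Ci(2) by (intro compact_space_fip[THEN iffD1, rule_format]) (auto simp: stone_space_def)
  then obtain y where y: "\<And>i. x \<in> B i \<Longrightarrow> y \<in> C i"
    by blast
  obtain k where "x \<in> B k"
    using baseB[of "topspace X"] x by auto
  then have yY: "y \<in> topspace Y"
    using y Ci(1) openin_subset by blast
  \<comment> \<open>Otherwise \<open>x\<close> has a neighbourhood \<open>B k\<close> disjoint from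
    \<open>B i\<close>, while \<open>C k\<close> and \<open>C i\<close> share \<open>y\<close> and
    hence a nonempty clopen \<open>C l\<close>; then \<open>B l\<close> lies in two disjoint
    sets.\<close>
  have "x \<in> B i" if "y \<in> C i" for i
  proof (rule ccontr)
    assume "x \<notin> B i"
    then obtain k where k: "x \<in> B k" "B k \<subseteq> topspace X - B i"
      using baseB[of "topspace X - B i"] x Bi by auto
    then have "y \<in> C k \<inter> C i" "openin Y (C k \<inter> C i)"
      using y that Ci by auto
    then obtain l where "C l \<subseteq> C k \<inter> C i"
      using stone_space_base[OF Y] C by (metis rangeE)
    then have "B l \<subseteq> B k \<inter> B i"
      using le by auto
    then show False
      using Bi(3)[of l] k by blast
  qed
  then show ?thesis
    using y yY by blast
qed

text \<open>The sets \<open>C i\<close> form a base of \<open>Y\<close>, and the preimage of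
  \<open>C i\<close> is the open set \<open>B i\<close>.\<close>

lemma continuous_map_stone_space:
  assumes Y: "stone_space Y" and B: "range B = nonempty_clopens X" and C: "range C = nonempty_clopens Y"
    and f: "\<And>x. x \<in> topspace X \<Longrightarrow> f x \<in> topspace Y"
    and fBC: "\<And>x i. x \<in> topspace X \<Longrightarrow> f x \<in> C i \<longleftrightarrow> x \<in> B i"
  shows "continuous_map X Y f"
  unfolding continuous_map_def
proof (intro conjI allI impI)
  fix W assume W: "openin Y W"
  show "openin X {x \<in> topspace X. f x \<in> W}"
  proof (subst openin_subopen, clarify)
    fix x assume x: "x \<in> topspace X" "f x \<in> W"
    then obtain i where i: "f x \<in> C i" "C i \<subseteq> W"
      using stone_space_base[OF Y W] C by (metis rangeE)
    have "openin X (B i)"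
      using B by (auto simp: nonempty_clopens_def)
    moreover have "B i \<subseteq> topspace X"
      using calculation openin_subset by blast
    ultimately show "\<exists>T. openin X T \<and> x \<in> T \<and> T \<subseteq> {x \<in> topspace X. f x \<in> W}"
      using i x fBC by (intro exI[of _ "B i"]) blast
  qed
qed (use f in auto)

text \<open>
  The image of a point is the unique common point of the clopen sets that correspond to its
  clopen neighbourhoods.
\<close>

lemma homeomorphic_map_from_clopen_order:
  fixes B :: "'i \<Rightarrow> 'a set" and C :: "'i \<Rightarrow> 'b set"
  assumes X: "stone_space X" and Y: "stone_space Y"
    and B: "range B = nonempty_clopens X" and C: "range C = nonempty_clopens Y"
    and le: "\<And>i j. B i \<subseteq> B j \<longleftrightarrow> C i \<subseteq> C j"
  obtains f where "homeomorphic_map X Y f" "\<And>x i. x \<in> topspace X \<Longrightarrow> f x \<in> C i \<longleftrightarrow> x \<in> B i"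
proof -
  have "\<exists>f. \<forall>x\<in>topspace X. f x \<in> topspace Y \<and> (\<forall>i. f x \<in> C i \<longleftrightarrow> x \<in> B i)"
    by (rule bchoice) (use stone_space_point_transfer[OF X Y B C le] in blast)
  then obtain f where f: "\<And>x. x \<in> topspace X \<Longrightarrow> f x \<in> topspace Y"
    "\<And>x i. x \<in> topspace X \<Longrightarrow> f x \<in> C i \<longleftrightarrow> x \<in> B i"
    by blast
  have "\<exists>g. \<forall>y\<in>topspace Y. g y \<in> topspace X \<and> (\<forall>i. g y \<in> B i \<longleftrightarrow> y \<in> C i)"
    by (rule bchoice) (use stone_space_point_transfer[OF Y X C B le[symmetric]] in blast)
  then obtain g where g: "\<And>y. y \<in> topspace Y \<Longrightarrow> g y \<in> topspace X"
    "\<And>y i. y \<in> topspace Y \<Longrightarrow> g y \<in> B i \<longleftrightarrow> y \<in> C i"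
    by blast
  have "g (f x) = x" if "x \<in> topspace X" for x
    by (rule stone_space_eqI[OF X]) (use that f g in \<open>auto simp: B[symmetric]\<close>)
  moreover have "f (g y) = y" if "y \<in> topspace Y" for y
    by (rule stone_space_eqI[OF Y]) (use that f g in \<open>auto simp: C[symmetric]\<close>)
  ultimately have "homeomorphic_maps X Y f g"
    using continuous_map_stone_space[OF Y B C f] continuous_map_stone_space[OF X C B g]
    by (simp add: homeomorphic_maps_def)
  then show ?thesis
    using that f homeomorphic_map_maps by blast
qed

lemma nonempty_clopens_homeomorphic_image:
  assumes "homeomorphic_map X Y f"
  shows "(`) f ` nonempty_clopens X = nonempty_clopens Y"
proof -
  obtain g where "homeomorphic_maps X Y f g"
    using assms homeomorphic_map_maps by blast
  then have g: "homeomorphic_map Y X g" and fg: "\<And>y. y \<in> topspace Y \<Longrightarrow> f (g y) = y"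
    by (auto simp: homeomorphic_maps_map)
  \<comment> \<open>Stated for arbitrary spaces so that it applies both to \<open>f\<close> and to
    its inverse \<open>g\<close>.\<close>
  have img: "h ` A \<in> nonempty_clopens Y'"
    if "homeomorphic_map X' Y' h" "A \<in> nonempty_clopens X'"
    for X' :: "'c topology" and Y' :: "'d topology" and h A
    using that homeomorphic_map_openness[OF that(1)] homeomorphic_map_closedness[OF that(1)]
    by (auto simp: nonempty_clopens_def openin_subset)
  have "\<exists>B\<in>nonempty_clopens X. A = f ` B" if A: "A \<in> nonempty_clopens Y" for A
  proof
    show "g ` A \<in> nonempty_clopens X"
      using img[OF g A] .
    have "A \<subseteq> topspace Y"
      using A openin_subset by (auto simp: nonempty_clopens_def)
    then show "A = f ` g ` A"
      using fg by (force simp: image_image)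
  qed
  then show ?thesis
    using img[OF assms] by blast
qed


section \<open>Stone groups\<close>

text \<open>These are the profinite groups: in a compact Hausdorff group, continuity of inversion
  follows from that of multiplication.\<close>

definition stone_group :: "('a, 'b) monoid_scheme \<Rightarrow> 'a topology \<Rightarrow> bool" where
  "stone_group G X \<longleftrightarrow> group G \<and> topspace X = carrier G \<and> stone_space X \<and>
     continuous_map (prod_topology X X) X (\<lambda>(x, y). x \<otimes>\<^bsub>G\<^esub> y)"

text \<open>The order gives a homeomorphism \<open>f\<close>. If the product of \<open>x\<close> and
  \<open>y\<close> lies in \<open>B k\<close>, continuity yields basic neighbourhoods with product
  inside \<open>B k\<close>; \<open>mult\<close> moves this to \<open>H\<close>, so the product of
  \<open>f x\<close> and \<open>f y\<close> lies in \<open>C k\<close>. Every clopen neighbourhood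
  of the image of the product thus contains the product of the images.\<close>

lemma topological_group_isomorphic_from_clopens:
  fixes B :: "'i \<Rightarrow> 'a set" and C :: "'i \<Rightarrow> 'b set"
  assumes G: "stone_group G X" and H: "stone_group H Y"
    and B: "range B = nonempty_clopens X" and C: "range C = nonempty_clopens Y"
    and le: "\<And>i j. B i \<subseteq> B j \<longleftrightarrow> C i \<subseteq> C j"
    and mult: "\<And>i j k. B i <#>\<^bsub>G\<^esub> B j \<subseteq> B k \<Longrightarrow> C i <#>\<^bsub>H\<^esub> C j \<subseteq> C k"
  shows "topological_group_isomorphic G X H Y"
proof -
  have X: "stone_space X" "topspace X = carrier G" "group G"
    and cont: "continuous_map (prod_topology X X) X (\<lambda>(x, y). x \<otimes>\<^bsub>G\<^esub> y)"
    using G by (auto simp: stone_group_def)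
  have Y: "stone_space Y" "topspace Y = carrier H" "group H"
    using H by (auto simp: stone_group_def)
  interpret G: group G by (fact X)
  interpret H: group H by (fact Y)
  obtain f where f: "homeomorphic_map X Y f"
    and fBC: "\<And>x i. x \<in> carrier G \<Longrightarrow> f x \<in> C i \<longleftrightarrow> x \<in> B i"
    using homeomorphic_map_from_clopen_order[OF X(1) Y(1) B C le] X(2) by metis
  have bij: "bij_betw f (carrier G) (carrier H)"
    using f X(2) Y(2) by (simp add: homeomorphic_eq_everything_map bij_betw_def)
  then have fc: "f x \<in> carrier H" if "x \<in> carrier G" for x
    using that bij_betwE by blast
  have hom: "f (x \<otimes>\<^bsub>G\<^esub> y) = f x \<otimes>\<^bsub>H\<^esub> f y" if xy: "x \<in> carrier G" "y \<in> carrier G" for x y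
  proof (rule stone_space_eqI[OF Y(1)])
    fix A assume "A \<in> nonempty_clopens Y" and fA: "f (x \<otimes>\<^bsub>G\<^esub> y) \<in> A"
    then obtain k where k: "A = C k"
      using C by blast
    have "openin X (B k)"
      using B by (auto simp: nonempty_clopens_def)
    define W where "W = {p \<in> topspace (prod_topology X X). (\<lambda>(x, y). x \<otimes>\<^bsub>G\<^esub> y) p \<in> B k}"
    have "openin (prod_topology X X) W"
      unfolding W_def using cont \<open>openin X (B k)\<close> by (rule openin_continuous_map_preimage)
    moreover have "(x, y) \<in> W"
      using fA k fBC xy by (auto simp: X(2) W_def)
    ultimately have "\<exists>U V. openin X U \<and> openin X V \<and> x \<in> U \<and> y \<in> V \<and> U \<times> V \<subseteq> W"
      using openin_prod_topology_alt[THEN iffD1, rule_format] by simp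
    then obtain U V where UV: "openin X U" "openin X V" "x \<in> U" "y \<in> V" "U \<times> V \<subseteq> W"
      by metis
    obtain i where i: "x \<in> B i" "B i \<subseteq> U"
      using stone_space_base[OF X(1) UV(1,3)] B by (metis rangeE)
    obtain j where j: "y \<in> B j" "B j \<subseteq> V"
      using stone_space_base[OF X(1) UV(2,4)] B by (metis rangeE)
    have "B i <#>\<^bsub>G\<^esub> B j \<subseteq> B k"
      using i j UV(5) by (fastforce simp: set_mult_def W_def)
    then have "C i <#>\<^bsub>H\<^esub> C j \<subseteq> C k"
      by (rule mult)
    moreover have "f x \<in> C i" "f y \<in> C j"
      using i j xy fBC by auto
    ultimately show "f x \<otimes>\<^bsub>H\<^esub> f y \<in> A"
      using k by (auto simp: set_mult_def)
  qed (use xy fc Y(2) in auto)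
  have "f \<in> iso G H"
    using bij hom fc by (auto simp: iso_def hom_def)
  then show ?thesis
    using f unfolding topological_group_isomorphic_def by blast
qed

lemma set_mult_image_subset_iff:
  assumes "f \<in> iso G H" "group G" "A \<subseteq> carrier G" "B \<subseteq> carrier G" "C \<subseteq> carrier G"
  shows "f ` A <#>\<^bsub>H\<^esub> f ` B \<subseteq> f ` C \<longleftrightarrow> A <#>\<^bsub>G\<^esub> B \<subseteq> C"
proof -
  interpret group G by fact
  have inj: "inj_on f (carrier G)" and hom: "f \<in> hom G H"
    using assms(1) by (auto simp: iso_def bij_betw_def)
  have "f ` A <#>\<^bsub>H\<^esub> f ` B = f ` (A <#>\<^bsub>G\<^esub> B)"
    using set_mult_hom[OF hom assms(3,4)] by simp
  moreover have "A <#>\<^bsub>G\<^esub> B \<subseteq> carrier G"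
    using assms by (simp add: setmult_subset_G)
  ultimately show ?thesis
    using inj_on_image_subset_iff[OF inj] assms(5) by metis
qed


section \<open>Quotients of Stone groups with a bi-invariant metric\<close>

text \<open>Everything about quotients is proved from these axioms, with \<open>Fhat\<close> as the
  intended instance. Continuity of multiplication is a consequence of bi-invariance.\<close>

locale bi_invariant_stone_group = group G + Metric_space "carrier G" d
  for G :: "('a, 'b) monoid_scheme" (structure) and d +
  assumes bi_invariant: "bi_invariant G d"
    and stone: "stone_space mtopology"
begin

section \<open>Isometric translations and uniformly open sets\<close>

lemma dist_mult_left:
  "\<lbrakk>x \<in> carrier G; y \<in> carrier G; z \<in> carrier G\<rbrakk> \<Longrightarrow> d (z \<otimes> x) (z \<otimes> y) = d x y"
  using bi_invariant by (simp add: bi_invariant_def)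

lemma dist_mult_right:
  "\<lbrakk>x \<in> carrier G; y \<in> carrier G; z \<in> carrier G\<rbrakk> \<Longrightarrow> d (x \<otimes> z) (y \<otimes> z) = d x y"
  using bi_invariant by (simp add: bi_invariant_def)

lemma compact: "compact_space mtopology"
  using stone by (simp add: stone_space_def)

text \<open>Openness with one radius for all points. The radius survives multiplication by a
  subgroup and measures how far the subgroup may be moved.\<close>

definition ball_invariant :: "real \<Rightarrow> 'a set \<Rightarrow> bool" where
  "ball_invariant e A \<longleftrightarrow> A \<subseteq> carrier G \<and> (\<forall>x\<in>A. mball x e \<subseteq> A)"

text \<open>By symmetry of \<open>d\<close>, the \<open>e\<close>-ball around a point outside
  \<open>A\<close> cannot meet \<open>A\<close>.\<close>

lemma ball_invariant_closed:
  assumes "e > 0" "ball_invariant e A"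
  shows "closedin mtopology A"
proof -
  have "disjnt A (mball x e)" if "x \<in> carrier G - A" for x
    using that assms(2) by (simp add: ball_invariant_def disjnt_iff subset_iff) (metis commute)
  then show ?thesis
    using assms by (auto simp: closedin_metric ball_invariant_def)
qed

text \<open>A closed set in a compact space is compact, and a Lebesgue number of its one-element
  cover \<open>{A}\<close> is the required radius.\<close>

lemma clopen_ball_invariant:
  assumes "A \<in> nonempty_clopens mtopology"
  obtains e where "e > 0" "ball_invariant e A"
proof -
  have A: "openin mtopology A" "closedin mtopology A"
    using assms by (auto simp: nonempty_clopens_def)
  then have "compactin mtopology A"
    using closedin_compact_space compact by blast
  then obtain e where "e > 0" and e: "\<And>x. x \<in> A \<Longrightarrow> \<exists>U\<in>{A}. mball x e \<subseteq> U"
    using lebesgue_number[of A "{A}"] A by auto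
  show ?thesis
    by (rule that[OF \<open>e > 0\<close>]) (use A(1) openin_subset[of mtopology] e in \<open>simp add: ball_invariant_def\<close>)
qed

text \<open>Left translation by \<open>n\<close> is an isometry, so a point near
  \<open>n \<otimes> a\<close> is \<open>n\<close> times a point equally near
  \<open>a\<close>.\<close>

lemma set_mult_open:
  assumes "N \<subseteq> carrier G" "openin mtopology A"
  shows "openin mtopology (N <#> A)"
  unfolding openin_mtopology
proof (intro conjI allI impI)
  have A: "A \<subseteq> carrier G"
    using openin_subset[OF assms(2)] by simp
  then show "N <#> A \<subseteq> carrier G"
    using assms(1) by (simp add: setmult_subset_G)
  fix x assume "x \<in> N <#> A"
  then obtain n a where na: "n \<in> N" "a \<in> A" "x = n \<otimes> a"
    by (auto simp: set_mult_def)
  then obtain r where r: "r > 0" "mball a r \<subseteq> A"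
    using assms(2) by (auto simp: openin_mtopology)
  have "y \<in> N <#> A" if "y \<in> mball x r" for y
  proof -
    have c: "n \<in> carrier G" "a \<in> carrier G" "y \<in> carrier G"
      using na A assms(1) that by auto
    have y: "y = n \<otimes> (inv n \<otimes> y)"
      using c by (simp flip: m_assoc)
    have "d a (inv n \<otimes> y) = d x y"
      using dist_mult_left[of a "inv n \<otimes> y" n] c y na(3) by simp
    then have "inv n \<otimes> y \<in> A"
      using r c that by auto
    then show ?thesis
      using na(1) y by (auto simp: set_mult_def)
  qed
  then show "\<exists>r>0. mball x r \<subseteq> N <#> A"
    using r(1) by blast
qed

text \<open>The translation argument of \<open>set_mult_open\<close> does not shrink the radius, so
  the same \<open>e\<close> works for every \<open>N\<close>.\<close>

lemma ball_invariant_set_mult: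
  assumes "N \<subseteq> carrier G" "ball_invariant e A"
  shows "ball_invariant e (N <#> A)"
  unfolding ball_invariant_def
proof (intro conjI ballI subsetI)
  have A: "A \<subseteq> carrier G"
    using assms(2) by (simp add: ball_invariant_def)
  show "x \<in> carrier G" if "x \<in> N <#> A" for x
    using that setmult_subset_G[OF assms(1) A] by blast
  fix x y assume "x \<in> N <#> A" and y: "y \<in> mball x e"
  then obtain n a where na: "n \<in> N" "a \<in> A" "x = n \<otimes> a"
    by (auto simp: set_mult_def)
  have c: "n \<in> carrier G" "a \<in> carrier G" "y \<in> carrier G"
    using na A assms(1) y by auto
  have y': "y = n \<otimes> (inv n \<otimes> y)"
    using c by (simp flip: m_assoc)
  have "d a (inv n \<otimes> y) = d x y"
    using dist_mult_left[of a "inv n \<otimes> y" n] c y' na(3) by simp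
  then have "inv n \<otimes> y \<in> A"
    using y c assms(2) na(2) unfolding ball_invariant_def by fastforce
  then show "y \<in> N <#> A"
    using na(1) y' by (auto simp: set_mult_def)
qed

text \<open>Change one factor at a time: the step from \<open>x\<close> to \<open>u\<close> is
  measured by right invariance, the step from \<open>y\<close> to \<open>v\<close> by left
  invariance.\<close>

lemma mult_ball:
  assumes "x \<in> carrier G" "y \<in> carrier G" "u \<in> mball x r" "v \<in> mball y s"
  shows "u \<otimes> v \<in> mball (x \<otimes> y) (r + s)"
proof -
  have c: "u \<in> carrier G" "v \<in> carrier G"
    using assms by auto
  have "d (x \<otimes> y) (u \<otimes> v) \<le> d (x \<otimes> y) (u \<otimes> y) + d (u \<otimes> y) (u \<otimes> v)"
    using c assms by (intro triangle) auto
  then show ?thesis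
    using c assms by (simp add: dist_mult_left dist_mult_right)
qed

end

section \<open>The quotient by a closed normal subgroup and its clopen sets\<close>

locale bi_invariant_stone_group_quotient = bi_invariant_stone_group +
  fixes N
  assumes N: "N \<in> closed_normal_subgroups G mtopology"
begin

abbreviation proj where "proj \<equiv> \<lambda>x. N #> x"

abbreviation "Q \<equiv> quotient_group_topology G mtopology N"

lemma normal: "N \<lhd> G" and closed: "closedin mtopology N"
  using N by (auto simp: closed_normal_subgroups_def)

sublocale normal N G
  by (rule normal)

lemma proj_eq_iff:
  assumes "x \<in> carrier G" "y \<in> carrier G"
  shows "N #> x = N #> y \<longleftrightarrow> (\<exists>n\<in>N. x = n \<otimes> y)"
proof
  assume "N #> x = N #> y"
  then have "x \<in> N #> y"
    using rcos_self[OF assms(1)] subgroup_axioms by auto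
  then show "\<exists>n\<in>N. x = n \<otimes> y"
    by (auto simp: r_coset_def)
next
  assume "\<exists>n\<in>N. x = n \<otimes> y"
  then have "x \<in> N #> y"
    by (auto simp: r_coset_def)
  then show "N #> x = N #> y"
    using repr_independence[OF _ assms(2)] subgroup_axioms by simp
qed

lemma proj_mem_image_iff:
  assumes "x \<in> carrier G" "A \<subseteq> carrier G"
  shows "N #> x \<in> proj ` A \<longleftrightarrow> x \<in> N <#> A"
proof -
  have "N #> x \<in> proj ` A \<longleftrightarrow> (\<exists>a\<in>A. \<exists>n\<in>N. x = n \<otimes> a)"
    using assms proj_eq_iff by (auto simp: image_iff subset_iff)
  then show ?thesis
    by (auto simp: set_mult_def)
qed

lemma proj_preimage:
  assumes "A \<subseteq> carrier G"
  shows "{x \<in> carrier G. N #> x \<in> proj ` A} = N <#> A"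
  using proj_mem_image_iff[OF _ assms] setmult_subset_G[OF subset assms] by (simp add: set_eq_iff subset_iff) metis

text \<open>\<open>N <#> A\<close> is the saturation of \<open>A\<close>, so inclusions in the
  quotient can be tested inside \<open>G\<close>. This is what the coding structure records.\<close>

lemma proj_image_subset_iff:
  assumes "A \<subseteq> carrier G" "B \<subseteq> carrier G"
  shows "proj ` A \<subseteq> proj ` B \<longleftrightarrow> N <#> A \<subseteq> N <#> B"
proof -
  have "proj ` A \<subseteq> proj ` B \<longleftrightarrow> (\<forall>x\<in>carrier G. N #> x \<in> proj ` A \<longrightarrow> N #> x \<in> proj ` B)"
    using assms(1) by auto
  also have "\<dots> \<longleftrightarrow> {x \<in> carrier G. N #> x \<in> proj ` A} \<subseteq> {x \<in> carrier G. N #> x \<in> proj ` B}"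
    by auto
  finally show ?thesis
    by (simp only: proj_preimage assms)
qed

lemma proj_image_set_mult:
  assumes "A \<subseteq> carrier G" "B \<subseteq> carrier G"
  shows "proj ` A <#>\<^bsub>G Mod N\<^esub> proj ` B = proj ` (A <#> B)"
  by (rule set_mult_hom[OF r_coset_hom_Mod assms, symmetric])

lemma openin_quotient_iff:
  "openin Q W \<longleftrightarrow> W \<subseteq> carrier (G Mod N) \<and> openin mtopology {x \<in> carrier G. N #> x \<in> W}"
  by (simp add: openin_quotient_group_topology)

lemma topspace_quotient: "topspace Q = carrier (G Mod N)"
proof (rule subset_antisym)
  show "topspace Q \<subseteq> carrier (G Mod N)"
    using openin_topspace[of Q] openin_quotient_iff by blast
  have "{x \<in> carrier G. N #> x \<in> carrier (G Mod N)} = carrier G"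
    by (auto simp: carrier_FactGroup)
  then have "openin Q (carrier (G Mod N))"
    by (simp add: openin_quotient_iff)
  then show "carrier (G Mod N) \<subseteq> topspace Q"
    by (rule openin_subset)
qed

lemma continuous_proj: "continuous_map mtopology Q proj"
  unfolding continuous_map_def
  by (auto simp: topspace_quotient carrier_FactGroup openin_quotient_iff)

lemma proj_open:
  assumes "openin mtopology A"
  shows "openin Q (proj ` A)"
proof -
  have "A \<subseteq> carrier G"
    using openin_subset[OF assms] by simp
  then show ?thesis
    using set_mult_open[OF subset assms]
    by (auto simp: openin_quotient_iff proj_preimage carrier_FactGroup)
qed

text \<open>Openness is immediate from \<open>proj_open\<close>. For closedness, the saturation
  \<open>N <#> A\<close> inherits a ball radius from \<open>A\<close>, and uniformly open sets are
  closed.\<close>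

lemma proj_clopen:
  assumes "A \<in> nonempty_clopens mtopology"
  shows "proj ` A \<in> nonempty_clopens Q"
proof -
  have A: "A \<subseteq> carrier G" "openin mtopology A" "A \<noteq> {}"
    using assms openin_subset[of mtopology A] by (auto simp: nonempty_clopens_def)
  obtain e where "e > 0" "ball_invariant e A"
    using assms by (rule clopen_ball_invariant)
  then have "closedin mtopology (N <#> A)"
    using ball_invariant_closed ball_invariant_set_mult[OF subset] by blast
  then have "openin mtopology (carrier G - (N <#> A))"
    by (simp add: closedin_def)
  moreover have "carrier G - (N <#> A) = {x \<in> carrier G. N #> x \<in> carrier (G Mod N) - proj ` A}"
    using proj_preimage[OF A(1)] by (auto simp: carrier_FactGroup)
  ultimately have "openin Q (carrier (G Mod N) - proj ` A)"
    by (simp add: openin_quotient_iff)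
  then have "closedin Q (proj ` A)"
    using A(1) by (auto simp: closedin_def topspace_quotient carrier_FactGroup)
  then show ?thesis
    using proj_open[OF A(2)] A(3) by (simp add: nonempty_clopens_def)
qed

text \<open>A clopen set of the quotient is the image of its preimage. Hence one family, the clopen
  sets of \<open>G\<close>, names the clopen sets of all quotients at once.\<close>

lemma proj_image_clopens: "(`) proj ` nonempty_clopens mtopology = nonempty_clopens Q"
proof -
  have "\<exists>A\<in>nonempty_clopens mtopology. W = proj ` A" if W: "W \<in> nonempty_clopens Q" for W
  proof
    let ?A = "{x \<in> topspace mtopology. N #> x \<in> W}"
    have WQ: "W \<subseteq> carrier (G Mod N)" "W \<noteq> {}"
      using W by (auto simp: nonempty_clopens_def openin_quotient_iff)
    have "openin mtopology ?A" "closedin mtopology ?A"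
      using W openin_continuous_map_preimage[OF continuous_proj]
        closedin_continuous_map_preimage[OF continuous_proj]
      by (auto simp: nonempty_clopens_def)
    moreover have "W = proj ` ?A"
      using WQ(1) by (auto simp: carrier_FactGroup)
    ultimately show "?A \<in> nonempty_clopens mtopology" "W = proj ` ?A"
      using WQ(2) by (auto simp: nonempty_clopens_def)
  qed
  then show ?thesis
    using proj_clopen by blast
qed

section \<open>The quotient is a Stone group\<close>

lemma compact_quotient: "compact_space Q"
proof -
  have "compactin Q (proj ` topspace mtopology)"
    using image_compactin[OF _ continuous_proj] compact by (simp add: compact_space_def)
  then show ?thesis
    by (simp add: compact_space_def topspace_quotient carrier_FactGroup)
qed

text \<open>Right translation by \<open>inv x\<close> is an isometry that carries the coset to the
  closed set \<open>N\<close>.\<close>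

lemma coset_closed:
  assumes "x \<in> carrier G"
  shows "closedin mtopology (N #> x)"
proof -
  have "\<exists>r>0. disjnt (N #> x) (mball y r)" if y: "y \<in> carrier G - (N #> x)" for y
  proof -
    have "y \<otimes> inv x \<in> carrier G - N"
      using y assms by (auto simp: r_coset_def m_assoc)
    then obtain r where r: "r > 0" "disjnt N (mball (y \<otimes> inv x) r)"
      using closed unfolding closedin_metric by metis
    have "n \<otimes> x \<notin> mball y r" if n: "n \<in> N" for n
    proof
      assume "n \<otimes> x \<in> mball y r"
      moreover have "d (y \<otimes> inv x) (n \<otimes> x \<otimes> inv x) = d y (n \<otimes> x)"
        using n y assms by (intro dist_mult_right) auto
      moreover have "n \<otimes> x \<otimes> inv x = n"
        using n assms by (simp add: m_assoc)
      ultimately have "n \<in> mball (y \<otimes> inv x) r"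
        using n y assms by auto
      then show False
        using r(2) n by (auto simp: disjnt_iff)
    qed
    then show ?thesis
      using r(1) by (auto simp: disjnt_iff r_coset_def)
  qed
  then show ?thesis
    using r_coset_subset_G[OF subset assms] by (simp add: closedin_metric)
qed

lemma quotient_base:
  assumes "openin Q W" "X \<in> W"
  shows "\<exists>B\<in>nonempty_clopens Q. X \<in> B \<and> B \<subseteq> W"
proof -
  obtain x where x: "x \<in> carrier G" "X = N #> x"
    using assms by (auto simp: openin_quotient_iff carrier_FactGroup)
  have "openin mtopology {x \<in> carrier G. N #> x \<in> W}"
    using assms(1) by (simp add: openin_quotient_iff)
  then obtain A where "A \<in> nonempty_clopens mtopology" "x \<in> A" "A \<subseteq> {x \<in> carrier G. N #> x \<in> W}"
    using stone_space_base[OF stone] x assms(2) by blast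
  then show ?thesis
    using proj_clopen x by (intro bexI[of _ "proj ` A"]) auto
qed

text \<open>The complement of a coset is open and saturated, so its image is an open set that omits
  exactly that coset.\<close>

lemma t0_quotient: "t0_space Q"
  unfolding t0_space_def topspace_quotient
proof (intro ballI impI)
  fix X Y assume "X \<in> carrier (G Mod N)" "Y \<in> carrier (G Mod N)" "X \<noteq> Y"
  then obtain x y where xy: "x \<in> carrier G" "y \<in> carrier G" "X = N #> x" "Y = N #> y" "N #> x \<noteq> N #> y"
    by (auto simp: carrier_FactGroup)
  define A where "A = carrier G - (N #> x)"
  have A: "openin mtopology A" "A \<subseteq> carrier G"
    using coset_closed[OF xy(1)] by (auto simp: A_def closedin_def)
  have memA: "z \<in> A \<longleftrightarrow> N #> z \<noteq> N #> x" if "z \<in> carrier G" for z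
    using that xy(1) proj_eq_iff by (auto simp: A_def r_coset_def)
  have "N #> x \<notin> proj ` A"
    using memA A(2) by (metis imageE subsetD)
  moreover have "N #> y \<in> proj ` A"
    using memA[OF xy(2)] xy(5) by simp
  ultimately show "\<exists>U. openin Q U \<and> (X \<notin> U) = (Y \<in> U)"
    using proj_open[OF A(1)] xy(3,4) by metis
qed

lemma continuous_mult_quotient:
  "continuous_map (prod_topology Q Q) Q (\<lambda>(X, Y). X \<otimes>\<^bsub>G Mod N\<^esub> Y)"
  unfolding continuous_map_def
proof (intro conjI allI impI)
  have closed: "X \<otimes>\<^bsub>G Mod N\<^esub> Y \<in> carrier (G Mod N)"
    if "X \<in> carrier (G Mod N)" "Y \<in> carrier (G Mod N)" for X Y
    using group.is_monoid[OF factorgroup_is_group] that by (rule monoid.m_closed)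
  then show "(\<lambda>(X, Y). X \<otimes>\<^bsub>G Mod N\<^esub> Y) \<in> topspace (prod_topology Q Q) \<rightarrow> topspace Q"
    by (auto simp: topspace_quotient simp del: mult_FactGroup)
  fix W assume W: "openin Q W"
  show "openin (prod_topology Q Q) {p \<in> topspace (prod_topology Q Q). (case p of (X, Y) \<Rightarrow> X \<otimes>\<^bsub>G Mod N\<^esub> Y) \<in> W}"
    unfolding openin_prod_topology_alt
  proof (intro allI impI)
    fix X Y
    assume "(X, Y) \<in> {p \<in> topspace (prod_topology Q Q). (case p of (X, Y) \<Rightarrow> X \<otimes>\<^bsub>G Mod N\<^esub> Y) \<in> W}"
    then obtain x y where xy: "x \<in> carrier G" "y \<in> carrier G" "X = N #> x" "Y = N #> y" "N #> (x \<otimes> y) \<in> W"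
      by (auto simp: topspace_quotient carrier_FactGroup rcos_sum)
    have "openin mtopology {z \<in> carrier G. N #> z \<in> W}"
      using W by (simp add: openin_quotient_iff)
    then obtain r where r: "r > 0" "mball (x \<otimes> y) r \<subseteq> {z \<in> carrier G. N #> z \<in> W}"
      using xy unfolding openin_mtopology by blast
    \<comment> \<open>By \<open>mult_ball\<close>, balls of radius \<open>r/2\<close> multiply into
      the ball of radius \<open>r\<close>, and their images are open since the projection is
      open.\<close>
    let ?U = "proj ` mball x (r/2)" and ?V = "proj ` mball y (r/2)"
    have "N #> (u \<otimes> v) \<in> W" if "u \<in> mball x (r/2)" "v \<in> mball y (r/2)" for u v
      using mult_ball[OF xy(1,2) that] r(2) by auto
    then have "?U \<times> ?V \<subseteq> {p \<in> topspace (prod_topology Q Q). (case p of (X, Y) \<Rightarrow> X \<otimes>\<^bsub>G Mod N\<^esub> Y) \<in> W}"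
      by (auto simp: topspace_quotient carrier_FactGroup rcos_sum)
    moreover have "X \<in> ?U" "Y \<in> ?V"
      using xy r(1) by auto
    moreover have "openin Q ?U" "openin Q ?V"
      by (auto intro: proj_open)
    ultimately show "\<exists>U V. openin Q U \<and> openin Q V \<and> X \<in> U \<and> Y \<in> V \<and>
        U \<times> V \<subseteq> {p \<in> topspace (prod_topology Q Q). (case p of (X, Y) \<Rightarrow> X \<otimes>\<^bsub>G Mod N\<^esub> Y) \<in> W}"
      by (intro exI conjI)
  qed
qed

lemma stone_group_quotient: "stone_group (G Mod N) Q"
  unfolding stone_group_def stone_space_def
  using factorgroup_is_group topspace_quotient compact_quotient t0_quotient quotient_base
    continuous_mult_quotient by blast

end


section \<open>The Hausdorff metric\<close>

context Metric_space
begin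

text \<open>The directed Hausdorff distance from \<open>A\<close> to \<open>B\<close>.\<close>

definition excess :: "'a set \<Rightarrow> 'a set \<Rightarrow> real" where
  "excess A B = (SUP x\<in>A. INF y\<in>B. d x y)"

lemma hausdorff_metric_excess:
  "hausdorff_metric C d A B = (if A \<in> C \<and> B \<in> C then max (excess A B) (excess B A) else 0)"
  by (simp add: hausdorff_metric_def excess_def commute)

text \<open>Real suprema say something only about bounded sets: compactness bounds \<open>d\<close>,
  hence the infima, so each of them lies below the supremum.\<close>

lemma excess_lessD:
  assumes "compact_space mtopology" "A \<subseteq> M" "B \<subseteq> M" "B \<noteq> {}" "excess A B < e" "x \<in> A"
  shows "\<exists>y\<in>B. d x y < e"
proof -
  have bdd: "bdd_below (d x ` B)" for x
    by (meson bdd_belowI2 nonneg)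
  obtain K where K: "\<And>x y. x \<in> M \<Longrightarrow> y \<in> M \<Longrightarrow> d x y \<le> K"
    using compactin_imp_mbounded[of M] assms(1) unfolding mbounded_alt compact_space_def by auto
  obtain b where b: "b \<in> B"
    using assms(4) by blast
  have "(INF y\<in>B. d x y) \<le> K" if "x \<in> A" for x
    by (rule cINF_lower2[OF bdd b]) (use K that b assms(2,3) in blast)
  then have "bdd_above ((\<lambda>x. INF y\<in>B. d x y) ` A)"
    by (meson bdd_aboveI2)
  then have "(INF y\<in>B. d x y) < e"
    using cSUP_upper[OF assms(6)] assms(5) unfolding excess_def by (meson le_less_trans)
  then show ?thesis
    using cINF_less_iff[OF assms(4) bdd] by blast
qed

lemma excess_leI:
  assumes "A \<noteq> {}" "\<And>x. x \<in> A \<Longrightarrow> \<exists>y\<in>B. d x y \<le> e"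
  shows "excess A B \<le> e"
  unfolding excess_def
proof (rule cSUP_least[OF assms(1)])
  fix x assume "x \<in> A"
  then obtain y where "y \<in> B" "d x y \<le> e"
    using assms(2) by blast
  moreover have "bdd_below (d x ` B)"
    by (meson bdd_belowI2 nonneg)
  ultimately show "(INF y\<in>B. d x y) \<le> e"
    by (meson cINF_lower2)
qed

text \<open>Compactness keeps the suprema finite, nonemptiness gives the infima meaning, and
  closedness turns excess 0 into inclusion.\<close>

lemma Metric_space_hausdorff_metric:
  assumes comp: "compact_space mtopology"
    and C: "\<And>A. A \<in> C \<Longrightarrow> closedin mtopology A \<and> A \<noteq> {}"
  shows "Metric_space C (hausdorff_metric C d)"
proof
  have CM: "A \<subseteq> M" if "A \<in> C" for A
    using C[OF that] closedin_subset by fastforce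
  note lessD = excess_lessD[OF comp CM CM]
  have excess_nonneg: "0 \<le> excess A B" if AB: "A \<in> C" "B \<in> C" for A B
  proof (rule ccontr)
    assume "\<not> 0 \<le> excess A B"
    then have "excess A B < 0"
      by simp
    moreover obtain x where "x \<in> A"
      using C[OF AB(1)] by blast
    ultimately show False
      using lessD[OF AB] C AB by (meson nonneg not_le)
  qed
  have excess_eq_0: "A \<subseteq> B" if AB: "A \<in> C" "B \<in> C" "excess A B \<le> 0" for A B
  proof (rule subsetI, rule ccontr)
    fix x assume x: "x \<in> A" "x \<notin> B"
    then have "x \<in> M - B"
      using CM AB by blast
    then obtain r where r: "r > 0" "disjnt B (mball x r)"
      using C[OF AB(2)] unfolding closedin_metric by metis
    \<comment> \<open>Excess at most 0 is below \<open>r\<close>, which puts a point of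
      \<open>B\<close> into a ball that misses \<open>B\<close>.\<close>
    then have "\<exists>y\<in>B. d x y < r"
      using lessD[OF AB(1,2) _ _ x(1), of r] C[OF AB(2)] AB(3) by simp
    then show False
      using r \<open>x \<in> M - B\<close> CM[OF AB(2)] by (auto simp: disjnt_iff)
  qed
  have excess_triangle: "excess A D \<le> excess A B + excess B D"
    if ABD: "A \<in> C" "B \<in> C" "D \<in> C" for A B D
  \<comment> \<open>The margin \<open>e\<close>, split into halves, provides near-optimal points
    without asking whether the infima are attained.\<close>
  proof (rule field_le_epsilon)
    fix e :: real assume e: "e > 0"
    show "excess A D \<le> excess A B + excess B D + e"
    proof (rule excess_leI)
      fix x assume x: "x \<in> A"
      obtain y where y: "y \<in> B" "d x y < excess A B + e / 2"
        using lessD[OF ABD(1,2) _ _ x, of "excess A B + e / 2"] C ABD e by auto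
      obtain z where z: "z \<in> D" "d y z < excess B D + e / 2"
        using lessD[OF ABD(2,3) _ _ y(1), of "excess B D + e / 2"] C ABD e by auto
      have "d x z \<le> d x y + d y z"
        using x y z CM ABD by (intro triangle) auto
      then show "\<exists>z\<in>D. d x z \<le> excess A B + excess B D + e"
        using y z by (intro bexI[of _ z]) auto
    qed (use C ABD in blast)
  qed
  fix A B D
  show "0 \<le> hausdorff_metric C d A B"
    using excess_nonneg by (simp add: hausdorff_metric_excess le_max_iff_disj)
  show "hausdorff_metric C d A B = hausdorff_metric C d B A"
    by (simp add: hausdorff_metric_excess max.commute)
  assume A: "A \<in> C" and B: "B \<in> C"
  show "hausdorff_metric C d A B = 0 \<longleftrightarrow> A = B"
  proof
    assume "hausdorff_metric C d A B = 0"
    then show "A = B"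
      using excess_eq_0[OF A B] excess_eq_0[OF B A] A B
      by (simp add: hausdorff_metric_excess max_def split: if_splits)
  next
    assume "A = B"
    moreover have "excess A A \<le> 0"
      using C[OF A] CM[OF A] by (intro excess_leI) (auto intro!: bexI)
    ultimately show "hausdorff_metric C d A B = 0"
      using A excess_nonneg[OF A A] by (simp add: hausdorff_metric_excess)
  qed
  assume D: "D \<in> C"
  show "hausdorff_metric C d A D \<le> hausdorff_metric C d A B + hausdorff_metric C d B D"
    using excess_triangle[OF A B D] excess_triangle[OF D B A] A B D
    unfolding hausdorff_metric_excess by (auto simp: max_def)
qed

end


section \<open>Coding by countable structures\<close>

text \<open>Decode \<open>n\<close> as a pair and enumerate by its first component; the free second
  component repeats each element infinitely often.\<close>

lemma infinite_fibre_enumeration: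
  assumes "countable S" "S \<noteq> {}"
  obtains e :: "nat \<Rightarrow> 'a" where "range e = S" "\<And>s. s \<in> S \<Longrightarrow> infinite (e -` {s})"
proof -
  define e where "e n = from_nat_into S (fst (prod_decode n))" for n
  have idx: "\<exists>k. \<forall>j. e (prod_encode (k, j)) = s" if "s \<in> S" for s
    using from_nat_into_surj[OF assms(1) that] by (auto simp: e_def)
  have "e n \<in> S" for n
    unfolding e_def by (rule from_nat_into[OF assms(2)])
  moreover have "s \<in> range e" if "s \<in> S" for s
    using idx[OF that] by (metis rangeI)
  ultimately have "range e = S"
    by blast
  moreover have "infinite (e -` {s})" if s: "s \<in> S" for s
  proof -
    obtain k where k: "\<And>j. e (prod_encode (k, j)) = s"
      using idx[OF s] by blast
    have "inj (\<lambda>j. prod_encode (k, j))"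
      by (auto intro: injI)
    then have "infinite (range (\<lambda>j. prod_encode (k, j)))"
      by (rule range_inj_infinite)
    moreover have "range (\<lambda>j. prod_encode (k, j)) \<subseteq> e -` {s}"
      using k by auto
    ultimately show ?thesis
      using finite_subset by blast
  qed
  ultimately show ?thesis
    by (rule that)
qed

text \<open>Over each value both fibres are infinite subsets of the natural numbers, so their
  increasing enumerations match them up. The fibres partition the natural numbers, so these
  bijections glue to a permutation.\<close>

lemma bij_between_infinite_fibres:
  fixes C D :: "nat \<Rightarrow> 'a"
  assumes "range C = range D"
    and "\<And>s. s \<in> range C \<Longrightarrow> infinite (C -` {s})" "\<And>s. s \<in> range D \<Longrightarrow> infinite (D -` {s})"
  obtains p where "bij p" "\<And>n. C (p n) = D n"
proof -
  have "\<exists>h. bij_betw h (D -` {s}) (C -` {s})" if "s \<in> range D" for s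
    using that assms bij_betw_trans[OF bij_betw_inv_into[OF bij_enumerate] bij_enumerate] by metis
  then obtain h where h: "\<And>s. s \<in> range D \<Longrightarrow> bij_betw (h s) (D -` {s}) (C -` {s})"
    by metis
  define p where "p n = h (D n) n" for n
  have Cp: "C (p n) = D n" for n
    using bij_betwE[OF h[of "D n"]] by (auto simp: p_def)
  have "inj p"
  proof (rule injI)
    fix m n assume mn: "p m = p n"
    then have D: "D m = D n"
      using Cp by metis
    have "inj_on (h (D n)) (D -` {D n})"
      using h[of "D n"] by (auto simp: bij_betw_def)
    then show "m = n"
      using mn D by (auto simp: p_def inj_on_def)
  qed
  moreover have "\<exists>n. p n = m" for m
  proof -
    have Cm: "C m \<in> range D"
      using assms(1) by blast
    then have "m \<in> h (C m) ` (D -` {C m})"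
      using h[of "C m"] by (auto simp: bij_betw_def)
    then obtain n where "D n = C m" "m = h (C m) n"
      by blast
    then show ?thesis
      by (intro exI[of _ n]) (simp add: p_def)
  qed
  ultimately have "bij p"
    by (metis bijI surjI surj_def)
  then show ?thesis
    using that Cp by blast
qed

lemma measurable_borel_of:
  assumes "continuous_map X Y f"
  shows "f \<in> borel_of X \<rightarrow>\<^sub>M borel_of Y"
  unfolding borel_of_def
proof (rule measurable_measure_of)
  have X: "{U. openin X U} \<subseteq> Pow (topspace X)"
    using openin_subset by blast
  show "{U. openin Y U} \<subseteq> Pow (topspace Y)"
    using openin_subset by blast
  show "f \<in> space (sigma (topspace X) {U. openin X U}) \<rightarrow> topspace Y"
    using assms X by (auto simp: space_measure_of_conv continuous_map_def)
  fix V assume "V \<in> {U. openin Y U}"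
  then have "openin X {x \<in> topspace X. f x \<in> V}"
    using assms openin_continuous_map_preimage by blast
  moreover have "f -` V \<inter> topspace X = {x \<in> topspace X. f x \<in> V}"
    by blast
  ultimately show "f -` V \<inter> space (sigma (topspace X) {U. openin X U}) \<in> sets (sigma (topspace X) {U. openin X U})"
    using X by (simp add: space_measure_of_conv sets_measure_of sigma_sets.Basic)
qed

text \<open>Symbol 0 stands for the binary relation \<open>A \<subseteq> B\<close> and symbol 1 for
  the ternary relation \<open>A B \<subseteq> C\<close>, whence the arity
  \<open>r + 2\<close>.\<close>

definition clopen_signature :: "nat signature" where
  "clopen_signature = \<lparr>rel_syms = {0, 1}, fun_syms = {}, rel_arity = (\<lambda>r. r + 2), fun_arity = (\<lambda>_. 0)\<rparr>"

lemma all_length_2_iff: "(\<forall>xs. length xs = 2 \<longrightarrow> P xs) \<longleftrightarrow> (\<forall>i j. P [i, j])"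
  by (auto simp: numeral_2_eq_2 length_Suc_conv)

lemma all_length_3_iff: "(\<forall>xs. length xs = 3 \<longrightarrow> P xs) \<longleftrightarrow> (\<forall>i j k. P [i, j, k])"
  by (auto simp: numeral_3_eq_3 length_Suc_conv)

lemma structure_isomorphic_clopen_signature:
  "structure_isomorphic clopen_signature A B \<longleftrightarrow> (\<exists>p. bij p \<and>
     (\<forall>i j. fst A 0 [i, j] \<longleftrightarrow> fst B 0 [p i, p j]) \<and>
     (\<forall>i j k. fst A 1 [i, j, k] \<longleftrightarrow> fst B 1 [p i, p j, p k]))"
  by (simp add: structure_isomorphic_def clopen_signature_def all_length_2_iff all_length_3_iff
      flip: numeral_2_eq_2 numeral_3_eq_3)

section \<open>The structure attached to a quotient\<close>

context bi_invariant_stone_group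
begin

text \<open>For each \<open>n\<close> take a finite net \<open>K n\<close> of radius
  \<open>1 / Suc n\<close>. A clopen set whose ball radius exceeds this is the union of the balls
  around its net points, so only finitely many sets arise for each \<open>n\<close>.\<close>

lemma countable_nonempty_clopens: "countable (nonempty_clopens mtopology)"
proof -
  have "\<exists>K. finite K \<and> carrier G \<subseteq> (\<Union>x\<in>K. mball x e)" if "e > 0" for e
    using compactin_imp_mtotally_bounded[of "carrier G"] compact that
    unfolding mtotally_bounded_def compact_space_def by auto
  then have "\<forall>n. \<exists>K. finite K \<and> carrier G \<subseteq> (\<Union>x\<in>K. mball x (1 / Suc n))"
    by simp
  then obtain K where K: "\<And>n. finite (K n)" "\<And>n. carrier G \<subseteq> (\<Union>x\<in>K n. mball x (1 / Suc n))"
    by metis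
  define F where "F n J = (\<Union>x\<in>J. mball x (1 / Suc n))" for n J
  have "A \<in> (\<Union>n. F n ` Pow (K n))" if A: "A \<in> nonempty_clopens mtopology" for A
  proof -
    obtain e where e: "e > 0" "ball_invariant e A"
      using A by (rule clopen_ball_invariant)
    then obtain n where n: "1 / Suc n < e"
      using nat_approx_posE by blast
    have inv: "y \<in> A" if "x \<in> A" "y \<in> mball x (1 / Suc n)" for x y
    proof -
      have "y \<in> mball x e" "mball x e \<subseteq> A"
        using e(2) n that by (auto simp: ball_invariant_def)
      then show ?thesis
        by blast
    qed
    have "A = F n (K n \<inter> A)"
    proof (rule subset_antisym)
      show "A \<subseteq> F n (K n \<inter> A)"
      proof
        fix y assume y: "y \<in> A"
        then have "y \<in> carrier G"
          using e(2) by (auto simp: ball_invariant_def)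
        then obtain x where x: "x \<in> K n" "y \<in> mball x (1 / Suc n)"
          using K(2)[of n] by blast
        \<comment> \<open>Symmetry of the distance: the centre lies in the ball around
          \<open>y\<close>, which stays inside \<open>A\<close>.\<close>
        then have "x \<in> A"
          using inv[OF y, of x] by (simp add: commute)
        then show "y \<in> F n (K n \<inter> A)"
          using x unfolding F_def by blast
      qed
      show "F n (K n \<inter> A) \<subseteq> A"
        using inv unfolding F_def by blast
    qed
    then show ?thesis
      by blast
  qed
  then have "nonempty_clopens mtopology \<subseteq> (\<Union>n. F n ` Pow (K n))"
    by blast
  moreover have "countable (\<Union>n. F n ` Pow (K n))"
    using K(1) by (intro countable_UN[OF countableI_type] countable_finite) simp
  ultimately show ?thesis
    by (rule countable_subset)
qed

lemma nonempty_clopens_nonempty: "nonempty_clopens mtopology \<noteq> {}"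
proof -
  have "carrier G \<in> nonempty_clopens mtopology"
    by (auto simp: nonempty_clopens_def)
  then show ?thesis
    by blast
qed

abbreviation N_space :: "'a set set" where
  "N_space \<equiv> closed_normal_subgroups G mtopology"

lemma N_spaceD:
  assumes "N \<in> N_space"
  shows "N \<subseteq> carrier G" "closedin mtopology N" "N \<noteq> {}"
  using assms normal_imp_subgroup subgroup.subset subgroup.one_closed
  by (fastforce simp: closed_normal_subgroups_def)+

text \<open>Right invariance puts \<open>n \<otimes> a\<close> within \<open>e\<close> of
  \<open>n' \<otimes> a\<close>. Left invariance then puts
  \<open>inv n' \<otimes> (n \<otimes> a)\<close> within \<open>e\<close> of \<open>a\<close>, hence
  into \<open>A\<close>.\<close>

lemma set_mult_subset_of_close:
  assumes "ball_invariant e A" "N \<subseteq> carrier G" "N' \<subseteq> carrier G"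
    and close: "\<And>n. n \<in> N \<Longrightarrow> \<exists>n'\<in>N'. d n n' < e"
  shows "N <#> A \<subseteq> N' <#> A"
proof
  fix x assume "x \<in> N <#> A"
  then obtain n a where na: "n \<in> N" "a \<in> A" "x = n \<otimes> a"
    by (auto simp: set_mult_def)
  then obtain n' where n': "n' \<in> N'" "d n n' < e"
    using close by blast
  have c: "n \<in> carrier G" "n' \<in> carrier G" "a \<in> carrier G"
    using na n' assms(1-3) by (auto simp: ball_invariant_def)
  have x: "x = n' \<otimes> (inv n' \<otimes> x)"
    using c na(3) by (simp flip: m_assoc)
  have "d a (inv n' \<otimes> x) = d (n' \<otimes> a) (n \<otimes> a)"
    using dist_mult_left[of a "inv n' \<otimes> x" n'] c x na(3) by simp
  also have "\<dots> < e"
    using n' c by (simp add: dist_mult_right commute)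
  finally have "inv n' \<otimes> x \<in> mball a e"
    using na(3) c by simp
  then have "inv n' \<otimes> x \<in> A"
    using assms(1) na(2) unfolding ball_invariant_def by blast
  then show "x \<in> N' <#> A"
    using x n'(1) by (auto simp: set_mult_def)
qed

lemma set_mult_locally_constant:
  assumes "A \<in> nonempty_clopens mtopology"
  obtains e where "e > 0" "\<And>N N'. \<lbrakk>N \<in> N_space; N' \<in> N_space; hausdorff_metric N_space d N N' < e\<rbrakk>
    \<Longrightarrow> N <#> A = N' <#> A"
proof -
  obtain e where e: "e > 0" "ball_invariant e A"
    using assms by (rule clopen_ball_invariant)
  show ?thesis
  proof (rule that[OF e(1)])
    fix N N' assume NN': "N \<in> N_space" "N' \<in> N_space" "hausdorff_metric N_space d N N' < e"
    then have "excess N N' < e" "excess N' N < e"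
      by (auto simp: hausdorff_metric_excess)
    then show "N <#> A = N' <#> A"
      using excess_lessD[OF compact] set_mult_subset_of_close[OF e(2)] N_spaceD NN'(1,2)
      by (intro subset_antisym) metis+
  qed
qed

text \<open>The quotient relations are expressed by saturations in \<open>G\<close>. The
  restrictions to valid symbols and tuples make the value a point of the extensional product spaces
  behind \<open>Mod_topology\<close>.\<close>

definition clopen_structure :: "(nat \<Rightarrow> 'a set) \<Rightarrow> 'a set \<Rightarrow> nat nat_structure" where
  "clopen_structure e N =
     (\<lambda>r\<in>{0, 1}. \<lambda>xs\<in>{xs. length xs = r + 2}.
        if r = 0 then N <#> e (xs ! 0) \<subseteq> N <#> e (xs ! 1)
        else N <#> e (xs ! 0) <#> e (xs ! 1) \<subseteq> N <#> e (xs ! 2),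
      \<lambda>f\<in>{}. undefined)"

lemma clopen_structure_simps:
  "fst (clopen_structure e N) 0 [i, j] \<longleftrightarrow> N <#> e i \<subseteq> N <#> e j"
  "fst (clopen_structure e N) 1 [i, j, k] \<longleftrightarrow> N <#> e i <#> e j \<subseteq> N <#> e k"
  by (simp_all add: clopen_structure_def)

lemma Metric_space_N_space: "Metric_space N_space (hausdorff_metric N_space d)"
  using compact N_spaceD by (intro Metric_space_hausdorff_metric) auto

text \<open>Each coordinate depends on \<open>N\<close> only through at most three saturations,
  which are locally constant by \<open>set_mult_locally_constant\<close>; the target has the product
  topology of discrete spaces.\<close>

lemma continuous_clopen_structure:
  assumes e: "range e = nonempty_clopens mtopology"
  shows "continuous_map (Metric_space.mtopology N_space (hausdorff_metric N_space d))
    (Mod_topology clopen_signature) (clopen_structure e)"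
proof -
  interpret H: Metric_space N_space "hausdorff_metric N_space d"
    by (rule Metric_space_N_space)
  have e_clopen: "e i \<in> nonempty_clopens mtopology" for i
    using e by blast
  have loc: "\<exists>s>0. \<forall>N'\<in>N_space. hausdorff_metric N_space d N N' < s \<longrightarrow>
      N <#> e i = N' <#> e i \<and> N <#> e j = N' <#> e j \<and> N <#> e k = N' <#> e k"
    if "N \<in> N_space" for N i j k
  proof -
    have *: "\<exists>s>0. \<forall>N'\<in>N_space. hausdorff_metric N_space d N N' < s \<longrightarrow> N <#> e i = N' <#> e i" for i
      using set_mult_locally_constant[OF e_clopen[of i]] that by metis
    obtain s t u where "s > 0" "t > 0" "u > 0"
      "\<forall>N'\<in>N_space. hausdorff_metric N_space d N N' < s \<longrightarrow> N <#> e i = N' <#> e i"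
      "\<forall>N'\<in>N_space. hausdorff_metric N_space d N N' < t \<longrightarrow> N <#> e j = N' <#> e j"
      "\<forall>N'\<in>N_space. hausdorff_metric N_space d N N' < u \<longrightarrow> N <#> e k = N' <#> e k"
      using *[of i] *[of j] *[of k] by metis
    then show ?thesis
      by (intro exI[of _ "min s (min t u)"]) simp
  qed
  have const: "continuous_map H.mtopology (discrete_topology UNIV) f"
    if f: "\<And>N N'. \<lbrakk>N \<in> N_space; N' \<in> N_space; N <#> e i = N' <#> e i; N <#> e j = N' <#> e j;
        N <#> e k = N' <#> e k\<rbrakk> \<Longrightarrow> f N = f N'"
    for f :: "'a set \<Rightarrow> bool" and i j k
    unfolding continuous_map_def
  proof (intro conjI allI impI)
    fix U
    show "openin H.mtopology {N \<in> topspace H.mtopology. f N \<in> U}"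
      unfolding H.openin_mtopology H.topspace_mtopology
    proof (intro conjI allI impI)
      fix N assume N: "N \<in> {N \<in> N_space. f N \<in> U}"
      then obtain s where s: "s > 0" "\<forall>N'\<in>N_space. hausdorff_metric N_space d N N' < s \<longrightarrow>
          N <#> e i = N' <#> e i \<and> N <#> e j = N' <#> e j \<and> N <#> e k = N' <#> e k"
        using loc by blast
      have "N' \<in> {N \<in> N_space. f N \<in> U}" if "N' \<in> H.mball N s" for N'
      proof -
        have N': "N' \<in> N_space" "hausdorff_metric N_space d N N' < s"
          using that by (simp_all add: H.in_mball)
        then have "f N = f N'"
          using s(2) N by (intro f) auto
        then show ?thesis
          using N N' by simp
      qed
      then show "\<exists>r>0. H.mball N r \<subseteq> {N \<in> N_space. f N \<in> U}"
        using s(1) by blast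
    qed blast
  qed simp
  have coord: "continuous_map H.mtopology (discrete_topology UNIV) (\<lambda>N. fst (clopen_structure e N) r xs)"
    if "r \<in> {0, 1}" "length xs = r + 2" for r xs
    \<comment> \<open>For \<open>r = 0\<close> the entry \<open>xs ! 2\<close> is out of range and
      denotes an unspecified index; the argument works with any third index.\<close>
    by (rule const[of "xs ! 0" "xs ! 1" "xs ! 2"]) (use that in \<open>auto simp: clopen_structure_def\<close>)
  show ?thesis
    unfolding Mod_topology_def continuous_map_pairwise o_def
  proof
    show "continuous_map H.mtopology (product_topology (\<lambda>r. product_topology (\<lambda>_. discrete_topology UNIV)
        {xs. length xs = rel_arity clopen_signature r}) (rel_syms clopen_signature))
        (\<lambda>N. fst (clopen_structure e N))"
      unfolding continuous_map_componentwise
      using coord by (auto simp: clopen_signature_def) (auto simp: clopen_structure_def)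
    show "continuous_map H.mtopology (product_topology (\<lambda>f. product_topology (\<lambda>_. discrete_topology UNIV)
        {xs. length xs = fun_arity clopen_signature f}) (fun_syms clopen_signature))
        (\<lambda>N. snd (clopen_structure e N))"
      unfolding continuous_map_componentwise
      by (auto simp: clopen_signature_def clopen_structure_def)
  qed
qed

text \<open>\<open>B\<close> and \<open>C\<close> name the clopen sets of the two quotients by the
  same indices. A topological isomorphism identifies the named sets, and infinite fibres let a
  permutation follow it on names; conversely, a permutation preserving both relations feeds
  \<open>topological_group_isomorphic_from_clopens\<close>.\<close>

lemma isomorphic_quotients_iff:
  assumes e: "range e = nonempty_clopens mtopology"
    and fibres: "\<And>A. A \<in> nonempty_clopens mtopology \<Longrightarrow> infinite (e -` {A})"
    and RS: "R \<in> N_space" "S \<in> N_space"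
  shows "topological_group_isomorphic (G Mod R) (quotient_group_topology G mtopology R)
      (G Mod S) (quotient_group_topology G mtopology S) \<longleftrightarrow>
    structure_isomorphic clopen_signature (clopen_structure e R) (clopen_structure e S)"
proof -
  interpret R: bi_invariant_stone_group_quotient G d R
    by unfold_locales (rule RS)
  interpret S: bi_invariant_stone_group_quotient G d S
    by unfold_locales (rule RS)
  define B where "B i = R.proj ` e i" for i
  define C where "C i = S.proj ` e i" for i
  have e_carrier: "e i \<subseteq> carrier G" for i
  proof -
    have "e i \<in> nonempty_clopens mtopology"
      using e by blast
    then show ?thesis
      using openin_subset[of mtopology "e i"] by (auto simp: nonempty_clopens_def)
  qed
  have range_B: "range B = nonempty_clopens R.Q"
    using R.proj_image_clopens by (metis B_def e image_cong image_image)
  have range_C: "range C = nonempty_clopens S.Q"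
    using S.proj_image_clopens by (metis C_def e image_cong image_image)
  have B_carrier: "B i \<subseteq> carrier (G Mod R)" for i
    using e_carrier by (auto simp: B_def carrier_FactGroup)
  have R_rel: "fst (clopen_structure e R) 0 [i, j] \<longleftrightarrow> B i \<subseteq> B j"
    "fst (clopen_structure e R) 1 [i, j, k] \<longleftrightarrow> B i <#>\<^bsub>G Mod R\<^esub> B j \<subseteq> B k" for i j k
    unfolding B_def R.proj_image_set_mult[OF e_carrier e_carrier] clopen_structure_simps
    by (simp_all only: R.proj_image_subset_iff setmult_subset_G e_carrier set_mult_assoc R.subset)
  have S_rel: "fst (clopen_structure e S) 0 [i, j] \<longleftrightarrow> C i \<subseteq> C j"
    "fst (clopen_structure e S) 1 [i, j, k] \<longleftrightarrow> C i <#>\<^bsub>G Mod S\<^esub> C j \<subseteq> C k" for i j k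
    unfolding C_def S.proj_image_set_mult[OF e_carrier e_carrier] clopen_structure_simps
    by (simp_all only: S.proj_image_subset_iff setmult_subset_G e_carrier set_mult_assoc S.subset)
  show ?thesis
    unfolding structure_isomorphic_clopen_signature R_rel S_rel
  proof
    assume "topological_group_isomorphic (G Mod R) R.Q (G Mod S) S.Q"
    then obtain f where f: "f \<in> iso (G Mod R) (G Mod S)" "homeomorphic_map R.Q S.Q f"
      unfolding topological_group_isomorphic_def by blast
    have inj: "inj_on f (carrier (G Mod R))"
      using f(1) by (simp add: iso_def bij_betw_def)
    \<comment> \<open>\<open>D\<close> names the clopen sets of the second quotient through
      \<open>f\<close>; it has the same range as \<open>C\<close>, so a permutation can match the
      two namings.\<close>
    define D where "D i = f ` B i" for i
    have "range D = (`) f ` range B"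
      by (auto simp: D_def)
    then have range_D: "range C = range D"
      using nonempty_clopens_homeomorphic_image[OF f(2)] range_B range_C by simp
    \<comment> \<open>A naming that factors through \<open>e\<close> has fibres containing fibres of
      \<open>e\<close>, so it inherits their infinitude.\<close>
    have inf: "infinite (h -` {s})" if "s \<in> range h" and h: "\<And>i j. e i = e j \<Longrightarrow> h i = h j"
      for h :: "nat \<Rightarrow> 'a set set" and s
    proof -
      obtain i where i: "s = h i"
        using \<open>s \<in> range h\<close> by blast
      have "e -` {e i} \<subseteq> h -` {s}"
        unfolding i by (rule subsetI) (simp, rule h, simp)
      moreover have "infinite (e -` {e i})"
        using e by (intro fibres) blast
      ultimately show ?thesis
        using finite_subset by blast
    qed
    have "infinite (C -` {s})" if "s \<in> range C" for s
      by (rule inf[OF that]) (simp add: C_def)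
    moreover have "infinite (D -` {s})" if "s \<in> range D" for s
      by (rule inf[OF that]) (simp add: D_def B_def)
    ultimately obtain p where p: "bij p" "\<And>n. C (p n) = D n"
      using bij_between_infinite_fibres[OF range_D] by metis
    have "B i \<subseteq> B j \<longleftrightarrow> C (p i) \<subseteq> C (p j)" for i j
      unfolding p(2) D_def using inj_on_image_subset_iff[OF inj B_carrier B_carrier] by simp
    moreover have "B i <#>\<^bsub>G Mod R\<^esub> B j \<subseteq> B k \<longleftrightarrow> C (p i) <#>\<^bsub>G Mod S\<^esub> C (p j) \<subseteq> C (p k)" for i j k
      unfolding p(2) D_def
      using set_mult_image_subset_iff[OF f(1) R.factorgroup_is_group B_carrier B_carrier B_carrier] by simp
    ultimately show "\<exists>p. bij p \<and> (\<forall>i j. B i \<subseteq> B j \<longleftrightarrow> C (p i) \<subseteq> C (p j)) \<and>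
        (\<forall>i j k. B i <#>\<^bsub>G Mod R\<^esub> B j \<subseteq> B k \<longleftrightarrow> C (p i) <#>\<^bsub>G Mod S\<^esub> C (p j) \<subseteq> C (p k))"
      using p(1) by blast
  next
    assume "\<exists>p. bij p \<and> (\<forall>i j. B i \<subseteq> B j \<longleftrightarrow> C (p i) \<subseteq> C (p j)) \<and>
        (\<forall>i j k. B i <#>\<^bsub>G Mod R\<^esub> B j \<subseteq> B k \<longleftrightarrow> C (p i) <#>\<^bsub>G Mod S\<^esub> C (p j) \<subseteq> C (p k))"
    then obtain p where p: "bij p" "\<And>i j. B i \<subseteq> B j \<longleftrightarrow> C (p i) \<subseteq> C (p j)"
      "\<And>i j k. B i <#>\<^bsub>G Mod R\<^esub> B j \<subseteq> B k \<longleftrightarrow> C (p i) <#>\<^bsub>G Mod S\<^esub> C (p j) \<subseteq> C (p k)"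
      by blast
    \<comment> \<open>Reindexing by the permutation \<open>p\<close> loses no clopen set, so
      \<open>B\<close> and the reindexed \<open>C\<close> are two namings with the same
      relations.\<close>
    have "range (\<lambda>i. C (p i)) = nonempty_clopens S.Q"
      using p(1) range_C by (metis bij_is_surj image_image)
    then show "topological_group_isomorphic (G Mod R) R.Q (G Mod S) S.Q"
      using p(2,3) range_B
      by (intro topological_group_isomorphic_from_clopens[OF R.stone_group_quotient
            S.stone_group_quotient, of B "\<lambda>i. C (p i)"]) simp_all
  qed
qed

theorem quotients_classifiable_by_countable_structures:
  "\<exists>(L :: nat signature) (g :: 'a set \<Rightarrow> nat nat_structure).
    countable_signature L \<and>
    g \<in> borel_of (Metric_space.mtopology N_space (hausdorff_metric N_space d)) \<rightarrow>\<^sub>M borel_of (Mod_topology L) \<and>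
    (\<forall>R\<in>N_space. \<forall>S\<in>N_space.
       topological_group_isomorphic (G Mod R) (quotient_group_topology G mtopology R)
         (G Mod S) (quotient_group_topology G mtopology S) \<longleftrightarrow> structure_isomorphic L (g R) (g S))"
proof -
  obtain e :: "nat \<Rightarrow> 'a set" where e: "range e = nonempty_clopens mtopology"
    and fibres: "\<And>A. A \<in> nonempty_clopens mtopology \<Longrightarrow> infinite (e -` {A})"
    using infinite_fibre_enumeration[OF countable_nonempty_clopens nonempty_clopens_nonempty] by metis
  show ?thesis
  proof (intro exI conjI ballI)
    show "countable_signature clopen_signature"
      by (simp add: countable_signature_def clopen_signature_def)
    show "clopen_structure e \<in> borel_of (Metric_space.mtopology N_space (hausdorff_metric N_space d))
        \<rightarrow>\<^sub>M borel_of (Mod_topology clopen_signature)"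
      by (rule measurable_borel_of[OF continuous_clopen_structure[OF e]])
  qed (rule isomorphic_quotients_iff[OF e fibres])
qed

end


section \<open>The free profinite group\<close>

lemma finite_carrier_admissible:
  assumes "U \<in> admissible"
  shows "finite (carrier (F_omega Mod U))"
  using assms by (simp add: admissible_def FactGroup_def)

abbreviation Fhat_product :: "profinite_elem topology" where
  "Fhat_product \<equiv> product_topology (\<lambda>U. discrete_topology (carrier (F_omega Mod U))) admissible"

lemma compact_Fhat_product: "compact_space Fhat_product"
  by (auto simp: compact_space_product_topology compact_space_discrete_topology
      finite_carrier_admissible)

text \<open>For fixed \<open>U\<close> and \<open>V\<close>, compatibility is a finite union over
  the cosets \<open>X\<close> of \<open>U\<close>, each piece constraining two discrete coordinates
  and hence closed. The carrier is the intersection over all pairs.\<close>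

lemma closedin_Fhat_carrier: "closedin Fhat_product Fhat_carrier"
proof -
  have closed: "closedin Fhat_product {a \<in> topspace Fhat_product. a U \<subseteq> a V}"
    if UV: "U \<in> admissible" "V \<in> admissible" for U V
  proof -
    have pre: "closedin Fhat_product {a \<in> topspace Fhat_product. a W \<in> K}"
      if "W \<in> admissible" "K \<subseteq> carrier (F_omega Mod W)" for W K
      using closedin_continuous_map_preimage[OF continuous_map_product_projection[OF that(1)],
          of "\<lambda>U. discrete_topology (carrier (F_omega Mod U))" K] that(2) by simp
    have "closedin Fhat_product ({a \<in> topspace Fhat_product. a U \<in> {X}} \<inter>
        {a \<in> topspace Fhat_product. a V \<in> {Y \<in> carrier (F_omega Mod V). X \<subseteq> Y}})"
      if "X \<in> carrier (F_omega Mod U)" for X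
      using UV that by (intro closedin_Int pre) auto
    then have "closedin Fhat_product (\<Union>X\<in>carrier (F_omega Mod U).
        {a \<in> topspace Fhat_product. a U \<in> {X}} \<inter>
        {a \<in> topspace Fhat_product. a V \<in> {Y \<in> carrier (F_omega Mod V). X \<subseteq> Y}})"
      using finite_carrier_admissible[OF UV(1)] by (intro closedin_Union) blast+
    also have "(\<Union>X\<in>carrier (F_omega Mod U).
        {a \<in> topspace Fhat_product. a U \<in> {X}} \<inter>
        {a \<in> topspace Fhat_product. a V \<in> {Y \<in> carrier (F_omega Mod V). X \<subseteq> Y}}) =
        {a \<in> topspace Fhat_product. a U \<subseteq> a V}"
      using UV by (auto simp: PiE_iff)
    finally show ?thesis .
  qed
  \<comment> \<open>Including the whole product keeps the family nonempty and its intersection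
    inside the product.\<close>
  let ?\<K> = "insert (topspace Fhat_product)
    {{a \<in> topspace Fhat_product. a U \<subseteq> a V} | U V. U \<in> admissible \<and> V \<in> admissible \<and> U \<subseteq> V}"
  have "closedin Fhat_product (\<Inter>?\<K>)"
    using closed closedin_topspace[of Fhat_product] by (intro closedin_Inter) (blast+)
  also have "\<Inter>?\<K> = Fhat_carrier"
    by (auto simp: Fhat_carrier_def)
  finally show ?thesis .
qed

lemma compact_space_Fhat: "compact_space Fhat_topology"
  unfolding Fhat_topology_def
  using closedin_compact_space[OF compact_Fhat_product closedin_Fhat_carrier]
  by (rule compact_space_subtopology)

text \<open>A basic open box is also closed, since every side is closed in its discrete factor; its
  trace on the carrier is the required clopen set.\<close>

lemma Fhat_clopen_base:
  assumes W: "openin Fhat_topology W" and x: "x \<in> W"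
  shows "\<exists>A\<in>nonempty_clopens Fhat_topology. x \<in> A \<and> A \<subseteq> W"
proof -
  obtain T where T: "openin Fhat_product T" "W = T \<inter> Fhat_carrier"
    using W unfolding Fhat_topology_def openin_subtopology by blast
  then have "x \<in> T"
    using x by blast
  then obtain B where B: "finite {U \<in> admissible. B U \<noteq> topspace (discrete_topology (carrier (F_omega Mod U)))}"
      "\<forall>U\<in>admissible. openin (discrete_topology (carrier (F_omega Mod U))) (B U)"
      "x \<in> Pi\<^sub>E admissible B" "Pi\<^sub>E admissible B \<subseteq> T"
    using T(1) unfolding openin_product_topology_alt by meson
  have "openin Fhat_product (Pi\<^sub>E admissible B)"
    using B by (simp add: openin_PiE_gen)
  moreover have "closedin Fhat_product (Pi\<^sub>E admissible B)"
    using B(2) by (simp add: closedin_product_topology)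
  ultimately have "openin Fhat_topology (Pi\<^sub>E admissible B \<inter> Fhat_carrier)"
    "closedin Fhat_topology (Pi\<^sub>E admissible B \<inter> Fhat_carrier)"
    unfolding Fhat_topology_def openin_subtopology closedin_subtopology by blast+
  moreover have "x \<in> Pi\<^sub>E admissible B \<inter> Fhat_carrier"
    using B(3) x T(2) by blast
  ultimately have "Pi\<^sub>E admissible B \<inter> Fhat_carrier \<in> nonempty_clopens Fhat_topology"
    unfolding nonempty_clopens_def by auto
  moreover have "Pi\<^sub>E admissible B \<inter> Fhat_carrier \<subseteq> W"
    using B(4) unfolding T(2) by (rule Int_mono) simp
  ultimately show ?thesis
    using \<open>x \<in> Pi\<^sub>E admissible B \<inter> Fhat_carrier\<close> by metis
qed

theorem theorem6p1:
  fixes \<delta> :: "profinite_elem \<Rightarrow> profinite_elem \<Rightarrow> real"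
  assumes "compatible_metric Fhat_topology \<delta>"
    and "bi_invariant Fhat \<delta>"
  shows "\<exists>(L :: nat signature) (g :: profinite_elem set \<Rightarrow> nat nat_structure).
    countable_signature L \<and>
    g \<in> borel_of (N_Fhat_topology \<delta>) \<rightarrow>\<^sub>M borel_of (Mod_topology L) \<and>
    (\<forall>R\<in>N_Fhat. \<forall>S\<in>N_Fhat.
       quotients_isomorphic R S \<longleftrightarrow> structure_isomorphic L (g R) (g S))"
proof -
  interpret M: Metric_space "carrier Fhat" \<delta>
    using assms(1) by (simp add: compatible_metric_def topspace_Fhat_topology)
  have top: "M.mtopology = Fhat_topology"
    using assms(1) by (simp add: compatible_metric_def topspace_Fhat_topology)
  \<comment> \<open>Separation comes from the metric, compactness and the clopen base from the
    inverse limit; together they make \<open>Fhat\<close> an instance of the general result.\<close>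
  have "t0_space Fhat_topology"
    using M.Hausdorff_space_mtopology by (simp add: top Hausdorff_imp_t0_space)
  then have "stone_space Fhat_topology"
    using compact_space_Fhat Fhat_clopen_base unfolding stone_space_def by blast
  then interpret bi_invariant_stone_group Fhat \<delta>
    using assms(2)
    by (intro bi_invariant_stone_group.intro bi_invariant_stone_group_axioms.intro
        group_Fhat M.Metric_space_axioms) (simp_all add: top)
  show ?thesis
    using quotients_classifiable_by_countable_structures
    unfolding quotients_isomorphic_def N_Fhat_topology_def top .
qed

end
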